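(* Let $\mathbf{A}$ be a strongly Fregean algebra and let $U\in\mathsf{Cm}(\mathbf{A})/\!\sim$. Then $(\overline{U},\bullet)$ is a Boolean group (i.e. a group in which every element is its own inverse).
   Context: Conventions. $\mathsf{Con}(\mathbf{A})$ is the congruence lattice of an algebra $\mathbf{A}$ (congruences are subsets of $A^2$). $\mathsf{Cm}(\mathbf{A})$ is the set of completely meet irreducible congruences; for $\eta\in\mathsf{Cm}(\mathbf{A})$, $\eta^{+}$ denotes the least congruence strictly greater than $\eta$. For $\alpha\le\beta$ in $\mathsf{Con}(\mathbf{A})$ let $I[\alpha,\beta]=\{\gamma:\alpha\le\gamma\le\beta\}$. Write $I[\alpha,\beta]\nearrow I[\gamma,\delta]$ (equivalently $I[\gamma,\delta]\searrow I[\alpha,\beta]$) if $\beta\wedge\gamma=\alpha$ and $\beta\vee\gamma=\delta$. Two intervals are projective if they are connected by a finite sequence of steps $\nearrow,\searrow$. When $\mathsf{Con}(\mathbf{A})$ is modular, for $\varphi,\psi\in\mathsf{Cm}(\mathbf{A})$ put $\varphi\sim\psi$ iff $I[\varphi,\varphi^{+}]$ and $I[\psi,\psi^{+}]$ are projective; this is an equivalence relation. The language contains a distinguished constant term $1$. $\Theta_{\mathbf{A}}(c,d)$ is the least congruence containing $(c,d)$. $\mathbf{A}$ is congruence orderable if $\Theta_{\mathbf{A}}(1,a)=\Theta_{\mathbf{A}}(1,b)$ implies $a=b$ for $a,b\in A$; it is $1$-regular if $1/\alpha=1/\beta$ implies $\alpha=\beta$ for $\alpha,\beta\in\mathsf{Con}(\mathbf{A})$;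 it is Fregean if it is both. $\mathbf{A}$ is strongly Fregean if every homomorphic image of $\mathbf{A}$ is Fregean (with respect to $1$) and the variety generated by $\mathbf{A}$ is congruence modular. For strongly Fregean $\mathbf{A}$, $\varphi\sim\psi$ implies $\varphi^{+}=\psi^{+}$. For $U=\eta/\!\sim$ put $\overline{U}:=U\cup\{\eta^{+}\}$ (independent of the choice of $\eta\in U$), and for $\varphi,\psi\in\overline{U}$ put $\varphi\bullet\psi:=(\varphi\div\psi)'\cap\eta^{+}$, where $\div$ is symmetric difference and $'$ is complement in $A^2$. *)

theory Defs
  imports "HOL-Algebra.Group" "HOL-Library.Countable_Set"
begin

section \<open>Algebras, terms, congruences\<close>

text \<open>
  A similarity type is given by a type \<open>'f\<close> of operation symbols with an arity function
  \<open>ar :: 'f \<Rightarrow> nat\<close>. An operation is a function on argument lists; only its values on lists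
  of the right length over the carrier matter.
\<close>

record ('a, 'f) ualg = "'a partial_object" +
  oper :: "'f \<Rightarrow> 'a list \<Rightarrow> 'a"

definition args :: "('f \<Rightarrow> nat) \<Rightarrow> ('a, 'f) ualg \<Rightarrow> 'f \<Rightarrow> 'a list set" where
  "args ar A f = {xs. length xs = ar f \<and> set xs \<subseteq> carrier A}"

definition ualgebra :: "('f \<Rightarrow> nat) \<Rightarrow> ('a, 'f) ualg \<Rightarrow> bool" where
  "ualgebra ar A \<longleftrightarrow>
     carrier A \<noteq> {} \<and> (\<forall>f. \<forall>xs \<in> args ar A f. oper A f xs \<in> carrier A)"

datatype ('f, 'v) trm = Var 'v | Op 'f "('f, 'v) trm list"

primrec wf_trm :: "('f \<Rightarrow> nat) \<Rightarrow> ('f, 'v) trm \<Rightarrow> bool" where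
  "wf_trm ar (Var x) \<longleftrightarrow> True"
| "wf_trm ar (Op f ts) \<longleftrightarrow> length ts = ar f \<and> list_all (wf_trm ar) ts"

primrec eval_trm :: "('a, 'f) ualg \<Rightarrow> ('v \<Rightarrow> 'a) \<Rightarrow> ('f, 'v) trm \<Rightarrow> 'a" where
  "eval_trm A \<rho> (Var x) = \<rho> x"
| "eval_trm A \<rho> (Op f ts) = oper A f (map (eval_trm A \<rho>) ts)"

text \<open>
  A constant term need not be closed: it is a term whose value does not depend on the
  assignment (such as \<open>x \<rightarrow> x\<close> in Hilbert algebras). Closed terms are a special case.
\<close>

definition constant_term :: "('f \<Rightarrow> nat) \<Rightarrow> ('a, 'f) ualg \<Rightarrow> ('f, nat) trm \<Rightarrow> bool" where
  "constant_term ar A t \<longleftrightarrow>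
     wf_trm ar t \<and>
     (\<forall>\<rho> \<sigma>. range \<rho> \<subseteq> carrier A \<longrightarrow> range \<sigma> \<subseteq> carrier A \<longrightarrow> eval_trm A \<rho> t = eval_trm A \<sigma> t)"

definition const_val :: "('a, 'f) ualg \<Rightarrow> ('f, nat) trm \<Rightarrow> 'a" where
  "const_val A t = (THE c. \<forall>\<rho>. range \<rho> \<subseteq> carrier A \<longrightarrow> eval_trm A \<rho> t = c)"

definition Con :: "('f \<Rightarrow> nat) \<Rightarrow> ('a, 'f) ualg \<Rightarrow> ('a \<times> 'a) set set" where
  "Con ar A = {\<theta>. equiv (carrier A) \<theta> \<and>
     (\<forall>f. \<forall>xs \<in> args ar A f. \<forall>ys \<in> args ar A f.
        list_all2 (\<lambda>x y. (x, y) \<in> \<theta>) xs ys \<longrightarrow> (oper A f xs, oper A f ys) \<in> \<theta>)}"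

definition con_gen :: "('f \<Rightarrow> nat) \<Rightarrow> ('a, 'f) ualg \<Rightarrow> ('a \<times> 'a) set \<Rightarrow> ('a \<times> 'a) set" where
  "con_gen ar A X = (LEAST \<theta>. \<theta> \<in> Con ar A \<and> X \<subseteq> \<theta>)"

text \<open>The meet of two congruences is their intersection.\<close>

definition con_join ::
  "('f \<Rightarrow> nat) \<Rightarrow> ('a, 'f) ualg \<Rightarrow> ('a \<times> 'a) set \<Rightarrow> ('a \<times> 'a) set \<Rightarrow> ('a \<times> 'a) set" where
  "con_join ar A \<alpha> \<beta> = con_gen ar A (\<alpha> \<union> \<beta>)"

definition congruence_modular :: "('f \<Rightarrow> nat) \<Rightarrow> ('a, 'f) ualg \<Rightarrow> bool" where
  "congruence_modular ar A \<longleftrightarrow>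
     (\<forall>\<alpha> \<in> Con ar A. \<forall>\<beta> \<in> Con ar A. \<forall>\<gamma> \<in> Con ar A.
        \<alpha> \<subseteq> \<gamma> \<longrightarrow> con_join ar A \<alpha> \<beta> \<inter> \<gamma> = con_join ar A \<alpha> (\<beta> \<inter> \<gamma>))"


section \<open>The variety generated by an algebra\<close>

text \<open>The variety generated by \<open>A\<close> is the class of all models of the identities of \<open>A\<close>.\<close>

definition sat_id :: "('a, 'f) ualg \<Rightarrow> ('f, nat) trm \<Rightarrow> ('f, nat) trm \<Rightarrow> bool" where
  "sat_id A s t \<longleftrightarrow> (\<forall>\<rho>. range \<rho> \<subseteq> carrier A \<longrightarrow> eval_trm A \<rho> s = eval_trm A \<rho> t)"

definition in_variety :: "('f \<Rightarrow> nat) \<Rightarrow> ('a, 'f) ualg \<Rightarrow> ('b, 'f) ualg \<Rightarrow> bool" where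
  "in_variety ar A B \<longleftrightarrow>
     ualgebra ar B \<and> (\<forall>s t. wf_trm ar s \<longrightarrow> wf_trm ar t \<longrightarrow> sat_id A s t \<longrightarrow> sat_id B s t)"

text \<open>
  HOL cannot quantify over the members of a variety on all types at once. It suffices to
  consider carriers inside one type that is large enough to hold copies of all countably
  generated members; the type chosen also holds a copy of \<open>A\<close>. Lemma
  \<open>congruence_modular_varietyD\<close> below shows that this is no restriction: members of the variety
  over every type are then congruence modular.
\<close>

definition congruence_modular_variety :: "('f \<Rightarrow> nat) \<Rightarrow> ('a, 'f) ualg \<Rightarrow> bool" where
  "congruence_modular_variety ar A \<longleftrightarrow>
     (\<forall>B :: (('f, 'a + nat) trm, 'f) ualg. in_variety ar A B \<longrightarrow> congruence_modular ar B)"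


section \<open>Fregean and strongly Fregean algebras\<close>

definition Theta :: "('f \<Rightarrow> nat) \<Rightarrow> ('a, 'f) ualg \<Rightarrow> 'a \<Rightarrow> 'a \<Rightarrow> ('a \<times> 'a) set" where
  "Theta ar A c d = con_gen ar A {(c, d)}"

definition congruence_orderable :: "('f \<Rightarrow> nat) \<Rightarrow> ('a, 'f) ualg \<Rightarrow> ('f, nat) trm \<Rightarrow> bool" where
  "congruence_orderable ar A t \<longleftrightarrow>
     (\<forall>a \<in> carrier A. \<forall>b \<in> carrier A.
        Theta ar A (const_val A t) a = Theta ar A (const_val A t) b \<longrightarrow> a = b)"

definition one_regular :: "('f \<Rightarrow> nat) \<Rightarrow> ('a, 'f) ualg \<Rightarrow> ('f, nat) trm \<Rightarrow> bool" where
  "one_regular ar A t \<longleftrightarrow>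
     (\<forall>\<alpha> \<in> Con ar A. \<forall>\<beta> \<in> Con ar A. \<alpha> `` {const_val A t} = \<beta> `` {const_val A t} \<longrightarrow> \<alpha> = \<beta>)"

definition Fregean :: "('f \<Rightarrow> nat) \<Rightarrow> ('a, 'f) ualg \<Rightarrow> ('f, nat) trm \<Rightarrow> bool" where
  "Fregean ar A t \<longleftrightarrow> congruence_orderable ar A t \<and> one_regular ar A t"

definition homomorphic_image :: "('f \<Rightarrow> nat) \<Rightarrow> ('a, 'f) ualg \<Rightarrow> ('b, 'f) ualg \<Rightarrow> bool" where
  "homomorphic_image ar A B \<longleftrightarrow>
     ualgebra ar B \<and>
     (\<exists>h. h ` carrier A = carrier B \<and>
        (\<forall>f. \<forall>xs \<in> args ar A f. h (oper A f xs) = oper B f (map h xs)))"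

text \<open>
  Up to isomorphism the homomorphic images of \<open>A\<close> are its quotients, whose elements are sets of
  elements of \<open>A\<close>; so homomorphic images with carrier in \<open>'a set\<close> represent all of them.
\<close>

definition strongly_Fregean :: "('f \<Rightarrow> nat) \<Rightarrow> ('a, 'f) ualg \<Rightarrow> ('f, nat) trm \<Rightarrow> bool" where
  "strongly_Fregean ar A t \<longleftrightarrow>
     (\<forall>B :: ('a set, 'f) ualg. homomorphic_image ar A B \<longrightarrow> Fregean ar B t) \<and>
     congruence_modular_variety ar A"


section \<open>Completely meet irreducible congruences and projectivity\<close>

text \<open>
  The meet of a set \<open>S\<close> of congruences is taken in \<open>Con(A)\<close>, so the empty meet is \<open>A \<times> A\<close>, and
  the total congruence is not completely meet irreducible.
\<close>

definition Cm :: "('f \<Rightarrow> nat) \<Rightarrow> ('a, 'f) ualg \<Rightarrow> ('a \<times> 'a) set set" where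
  "Cm ar A = {\<eta> \<in> Con ar A. \<forall>S \<subseteq> Con ar A. \<eta> = (carrier A \<times> carrier A) \<inter> \<Inter>S \<longrightarrow> \<eta> \<in> S}"

definition upper_cover ::
  "('f \<Rightarrow> nat) \<Rightarrow> ('a, 'f) ualg \<Rightarrow> ('a \<times> 'a) set \<Rightarrow> ('a \<times> 'a) set" where
  "upper_cover ar A \<eta> = (LEAST \<theta>. \<theta> \<in> Con ar A \<and> \<eta> \<subset> \<theta>)"

text \<open>An interval \<open>I[\<alpha>, \<beta>]\<close> is represented by its pair of end points \<open>(\<alpha>, \<beta>)\<close>.\<close>

type_synonym 'a interval = "('a \<times> 'a) set \<times> ('a \<times> 'a) set"

definition is_interval :: "('f \<Rightarrow> nat) \<Rightarrow> ('a, 'f) ualg \<Rightarrow> 'a interval \<Rightarrow> bool" where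
  "is_interval ar A I \<longleftrightarrow> fst I \<in> Con ar A \<and> snd I \<in> Con ar A \<and> fst I \<subseteq> snd I"

definition transposes_up ::
  "('f \<Rightarrow> nat) \<Rightarrow> ('a, 'f) ualg \<Rightarrow> 'a interval \<Rightarrow> 'a interval \<Rightarrow> bool" where
  "transposes_up ar A I J \<longleftrightarrow>
     is_interval ar A I \<and> is_interval ar A J \<and>
     snd I \<inter> fst J = fst I \<and> con_join ar A (snd I) (fst J) = snd J"

definition projective ::
  "('f \<Rightarrow> nat) \<Rightarrow> ('a, 'f) ualg \<Rightarrow> 'a interval \<Rightarrow> 'a interval \<Rightarrow> bool" where
  "projective ar A = equivclp (transposes_up ar A)"

definition Cm_rel :: "('f \<Rightarrow> nat) \<Rightarrow> ('a, 'f) ualg \<Rightarrow> (('a \<times> 'a) set \<times> ('a \<times> 'a) set) set" where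
  "Cm_rel ar A = {(\<phi>, \<psi>). \<phi> \<in> Cm ar A \<and> \<psi> \<in> Cm ar A \<and>
     projective ar A (\<phi>, upper_cover ar A \<phi>) (\<psi>, upper_cover ar A \<psi>)}"


section \<open>The operation on an extended class\<close>

text \<open>Both definitions take the representative \<open>\<eta> \<in> U\<close> that determines \<open>\<eta>\<^sup>+\<close> as a parameter.\<close>

definition extended_class ::
  "('f \<Rightarrow> nat) \<Rightarrow> ('a, 'f) ualg \<Rightarrow> ('a \<times> 'a) set \<Rightarrow> ('a \<times> 'a) set set \<Rightarrow> ('a \<times> 'a) set set" where
  "extended_class ar A \<eta> U = U \<union> {upper_cover ar A \<eta>}"

definition bullet ::
  "('f \<Rightarrow> nat) \<Rightarrow> ('a, 'f) ualg \<Rightarrow> ('a \<times> 'a) set \<Rightarrow>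
     ('a \<times> 'a) set \<Rightarrow> ('a \<times> 'a) set \<Rightarrow> ('a \<times> 'a) set" where
  "bullet ar A \<eta> \<phi> \<psi> = (carrier A \<times> carrier A - sym_diff \<phi> \<psi>) \<inter> upper_cover ar A \<eta>"

definition boolean_group :: "('b, 'm) monoid_scheme \<Rightarrow> bool" where
  "boolean_group G \<longleftrightarrow> group G \<and> (\<forall>x \<in> carrier G. inv\<^bsub>G\<^esub> x = x)"


section \<open>Congruence modularity of the variety does not depend on the type\<close>

lemma con_gen_eq:
  assumes A: "ualgebra ar A" and X: "X \<subseteq> carrier A \<times> carrier A"
  shows "con_gen ar A X = (carrier A \<times> carrier A) \<inter> \<Inter>{\<theta> \<in> Con ar A. X \<subseteq> \<theta>}" (is "_ = ?I")
    and "con_gen ar A X \<in> Con ar A"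
proof -
  have top: "carrier A \<times> carrier A \<in> Con ar A"
    using A by (auto simp: Con_def ualgebra_def equiv_def refl_on_def sym_def trans_def)
  have eqv: "equiv (carrier A) \<theta>" if "\<theta> \<in> Con ar A" for \<theta>
    using that by (auto simp: Con_def)
  have eq: "equiv (carrier A) ?I"
  proof (rule equivI)
    show "refl_on (carrier A) ?I" using eqv by (auto simp: equiv_def refl_on_def)
    show "sym ?I" using eqv by (auto simp: equiv_def intro!: symI dest: symD)
    show "trans ?I"
    proof (rule transI)
      fix x y z assume "(x, y) \<in> ?I" "(y, z) \<in> ?I"
      moreover have "trans \<theta>" if "\<theta> \<in> Con ar A" for \<theta>
        using eqv[OF that] by (simp add: equiv_def)
      ultimately show "(x, z) \<in> ?I" by (auto dest: transD)
    qed
  qed auto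
  have "(oper A f xs, oper A f ys) \<in> ?I"
    if "xs \<in> args ar A f" "ys \<in> args ar A f" "list_all2 (\<lambda>x y. (x, y) \<in> ?I) xs ys" for f xs ys
  proof -
    have "(oper A f xs, oper A f ys) \<in> \<theta>" if "\<theta> \<in> Con ar A" "X \<subseteq> \<theta>" for \<theta>
    proof -
      have "list_all2 (\<lambda>x y. (x, y) \<in> \<theta>) xs ys"
        using \<open>list_all2 _ xs ys\<close> that by (auto elim: list_all2_mono)
      thus ?thesis using that \<open>xs \<in> _\<close> \<open>ys \<in> _\<close> by (auto simp: Con_def)
    qed
    thus ?thesis using A \<open>xs \<in> _\<close> \<open>ys \<in> _\<close> by (auto simp: ualgebra_def)
  qed
  with eq have I: "?I \<in> Con ar A" by (auto simp: Con_def)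
  show 1: "con_gen ar A X = ?I"
    unfolding con_gen_def by (rule Least_equality) (use I X in auto)
  show "con_gen ar A X \<in> Con ar A" using I 1 by simp
qed

lemma Con_subset: "\<theta> \<in> Con ar A \<Longrightarrow> \<theta> \<subseteq> carrier A \<times> carrier A"
  by (auto simp: Con_def equiv_def)

lemma con_join_props:
  assumes "ualgebra ar A" "\<alpha> \<in> Con ar A" "\<beta> \<in> Con ar A"
  shows "con_join ar A \<alpha> \<beta> \<in> Con ar A" "\<alpha> \<subseteq> con_join ar A \<alpha> \<beta>" "\<beta> \<subseteq> con_join ar A \<alpha> \<beta>"
    and "\<And>\<theta>. \<theta> \<in> Con ar A \<Longrightarrow> \<alpha> \<subseteq> \<theta> \<Longrightarrow> \<beta> \<subseteq> \<theta> \<Longrightarrow> con_join ar A \<alpha> \<beta> \<subseteq> \<theta>"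
proof -
  have X: "\<alpha> \<union> \<beta> \<subseteq> carrier A \<times> carrier A" using assms Con_subset by blast
  note E = con_gen_eq[OF assms(1) X, folded con_join_def]
  show "con_join ar A \<alpha> \<beta> \<in> Con ar A" by (rule E(2))
  show "\<alpha> \<subseteq> con_join ar A \<alpha> \<beta>" "\<beta> \<subseteq> con_join ar A \<alpha> \<beta>" unfolding E(1) using X by auto
  show "con_join ar A \<alpha> \<beta> \<subseteq> \<theta>" if "\<theta> \<in> Con ar A" "\<alpha> \<subseteq> \<theta>" "\<beta> \<subseteq> \<theta>" for \<theta>
    unfolding E(1) using that by auto
qed

lemma Con_Int:
  assumes "\<alpha> \<in> Con ar A" "\<beta> \<in> Con ar A" shows "\<alpha> \<inter> \<beta> \<in> Con ar A"
proof -
  have "equiv (carrier A) (\<alpha> \<inter> \<beta>)"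
    using assms by (auto simp: Con_def equiv_def refl_on_def intro: sym_Int trans_Int)
  moreover have "list_all2 (\<lambda>x y. (x, y) \<in> \<alpha>) xs ys \<and> list_all2 (\<lambda>x y. (x, y) \<in> \<beta>) xs ys"
    if "list_all2 (\<lambda>x y. (x, y) \<in> \<alpha> \<inter> \<beta>) xs ys" for xs ys
    using that by (auto elim: list_all2_mono)
  ultimately show ?thesis using assms by (auto simp: Con_def)
qed

lemma con_join_rtrancl:
  assumes A: "ualgebra ar A" and a: "\<alpha> \<in> Con ar A" and b: "\<beta> \<in> Con ar A"
  shows "con_join ar A \<alpha> \<beta> \<subseteq> (\<alpha> \<union> \<beta>)\<^sup>* \<inter> carrier A \<times> carrier A" (is "_ \<subseteq> ?R")
proof (rule con_join_props(4)[OF A a b])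
  have eqs: "equiv (carrier A) \<alpha>" "equiv (carrier A) \<beta>" using a b by (auto simp: Con_def)
  have sub: "\<alpha> \<union> \<beta> \<subseteq> carrier A \<times> carrier A" using a b Con_subset by blast
  have "sym (\<alpha> \<union> \<beta>)" using eqs by (auto simp: equiv_def sym_Un)
  hence "sym ?R" by (intro sym_Int sym_rtrancl) (auto intro: symI)
  moreover have "trans ?R" by (intro trans_Int trans_rtrancl) (auto intro: transI)
  ultimately have "equiv (carrier A) ?R" by (auto simp: equiv_def refl_on_def)
  moreover have "(oper A f xs, oper A f ys) \<in> ?R"
    if xs: "xs \<in> args ar A f" and ys: "ys \<in> args ar A f"
      and l: "list_all2 (\<lambda>x y. (x, y) \<in> ?R) xs ys" for f xs ys
  proof -
    have one_step: "(oper A f us, oper A f vs) \<in> \<alpha> \<union> \<beta> \<and> vs \<in> args ar A f"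
      if us: "us \<in> args ar A f" and uv: "(us, vs) \<in> listrel1 (\<alpha> \<union> \<beta>)" for us vs
    proof -
      obtain ps x y qs where xy: "(x, y) \<in> \<alpha> \<union> \<beta>" "us = ps @ x # qs" "vs = ps @ y # qs"
        using uv by (auto simp: listrel1_def)
      have vs: "vs \<in> args ar A f" using us xy sub by (auto simp: args_def)
      have "list_all2 (\<lambda>x y. (x, y) \<in> \<theta>) us vs" if "\<theta> \<in> Con ar A" "(x, y) \<in> \<theta>" for \<theta>
        using that us xy(2,3)
        by (auto simp: Con_def equiv_def refl_on_def args_def
            intro!: list_all2_appendI list_all2_same[THEN iffD2])
      hence "(oper A f us, oper A f vs) \<in> \<theta>" if "\<theta> \<in> Con ar A" "(x, y) \<in> \<theta>" for \<theta>
        using that us vs by (auto simp: Con_def)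
      thus ?thesis using vs xy(1) a b by blast
    qed
    have "(xs, ys) \<in> listrel ((\<alpha> \<union> \<beta>)\<^sup>*)"
      using l by (auto simp: listrel_iff_zip list_all2_iff)
    hence "(xs, ys) \<in> (listrel1 (\<alpha> \<union> \<beta>))\<^sup>*" by (simp add: listrel_rtrancl_eq_rtrancl_listrel1)
    hence "(oper A f xs, oper A f ys) \<in> (\<alpha> \<union> \<beta>)\<^sup>* \<and> ys \<in> args ar A f"
    proof (induction rule: rtrancl_induct)
      case base thus ?case using xs by simp
    next
      case (step us vs)
      thus ?case using one_step by (meson rtrancl.rtrancl_into_rtrancl)
    qed
    thus ?thesis using A xs ys by (auto simp: ualgebra_def)
  qed
  ultimately show "?R \<in> Con ar A" by (auto simp: Con_def)
  show "\<alpha> \<subseteq> ?R" "\<beta> \<subseteq> ?R" using sub by auto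
qed

lemma rtrancl_finite_support:
  assumes "(a, b) \<in> R\<^sup>*"
  shows "\<exists>X. finite X \<and> a \<in> X \<and> b \<in> X \<and> X \<subseteq> insert a (Range R) \<and> (a, b) \<in> (R \<inter> X \<times> X)\<^sup>*"
  using assms
proof (induction rule: rtrancl_induct)
  case base thus ?case by (intro exI[of _ "{a}"]) auto
next
  case (step y z)
  then obtain X where X: "finite X" "a \<in> X" "y \<in> X" "X \<subseteq> insert a (Range R)"
    "(a, y) \<in> (R \<inter> X \<times> X)\<^sup>*" by blast
  have "(a, y) \<in> (R \<inter> insert z X \<times> insert z X)\<^sup>*"
    using X(5) by (rule rtrancl_mono[THEN subsetD, rotated]) auto
  moreover have "(y, z) \<in> R \<inter> insert z X \<times> insert z X" using step.hyps(2) X(3) by auto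
  ultimately have "(a, z) \<in> (R \<inter> insert z X \<times> insert z X)\<^sup>*"
    by (rule rtrancl_into_rtrancl)
  thus ?case using X step.hyps(2) by (intro exI[of _ "insert z X"]) auto
qed

lemma eval_closed:
  assumes "ualgebra ar A" "range \<rho> \<subseteq> carrier A" "wf_trm ar s"
  shows "eval_trm A \<rho> s \<in> carrier A"
  using assms(3)
proof (induction s)
  case (Var x) thus ?case using assms(2) by auto
next
  case (Op f ts)
  hence "map (eval_trm A \<rho>) ts \<in> args ar A f" by (auto simp: args_def list_all_iff)
  thus ?case using assms(1) by (simp add: ualgebra_def)
qed

lemma congruence_modular_varietyD:
  fixes A :: "('a, 'f) ualg" and B :: "('c, 'f) ualg"
  assumes M: "congruence_modular_variety ar A" and BV: "in_variety ar A B"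
  shows "congruence_modular ar B"
  unfolding congruence_modular_def
proof (intro ballI impI equalityI subsetI)
  fix \<alpha> \<beta> \<gamma> p
  assume c: "\<alpha> \<in> Con ar B" "\<beta> \<in> Con ar B" "\<gamma> \<in> Con ar B" and ag: "\<alpha> \<subseteq> \<gamma>"
  have B: "ualgebra ar B" using BV by (simp add: in_variety_def)
  have bg: "\<beta> \<inter> \<gamma> \<in> Con ar B" using c Con_Int by blast
  note J = con_join_props[OF B c(1,2)] and K = con_join_props[OF B c(1) bg]
  {
    assume "p \<in> con_join ar B \<alpha> (\<beta> \<inter> \<gamma>)"
    moreover have "con_join ar B \<alpha> (\<beta> \<inter> \<gamma>) \<subseteq> con_join ar B \<alpha> \<beta> \<inter> \<gamma>"
      using K(4)[OF J(1)] K(4)[OF c(3)] J(2,3) ag by blast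
    ultimately show "p \<in> con_join ar B \<alpha> \<beta> \<inter> \<gamma>" by blast
  next
    assume p: "p \<in> con_join ar B \<alpha> \<beta> \<inter> \<gamma>"
    obtain a b where ab: "p = (a, b)" by (cases p)
    have abR: "(a, b) \<in> (\<alpha> \<union> \<beta>)\<^sup>*" and abB: "a \<in> carrier B" "b \<in> carrier B"
      using p ab con_join_rtrancl[OF B c(1,2)] by auto
    obtain X where X: "finite X" "a \<in> X" "b \<in> X" "X \<subseteq> insert a (Range (\<alpha> \<union> \<beta>))"
      "(a, b) \<in> ((\<alpha> \<union> \<beta>) \<inter> X \<times> X)\<^sup>*"
      using rtrancl_finite_support[OF abR] by blast
    have XB: "X \<subseteq> carrier B" using X(4) abB c(1,2)[THEN Con_subset] by auto
    obtain g :: "nat \<Rightarrow> 'c" where g: "range g = X"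
      using X(1,2) by (metis countable_finite empty_iff range_from_nat_into)
    define T where "T = {s :: ('f, nat) trm. wf_trm ar s}"
    define S where "S = eval_trm B g ` T"
    define rep where "rep x = (SOME s. s \<in> T \<and> eval_trm B g s = x)" for x
    have rep: "rep x \<in> T" "eval_trm B g (rep x) = x" if "x \<in> S" for x
      using someI_ex[of "\<lambda>s. s \<in> T \<and> eval_trm B g s = x"] that by (auto simp: S_def rep_def)
    define j :: "'c \<Rightarrow> ('f, 'a + nat) trm" where "j x = map_trm id Inr (rep x)" for x
    have jinj: "inj_on j S"
    proof (rule inj_onI)
      fix x y assume "x \<in> S" "y \<in> S" "j x = j y"
      moreover have "inj (map_trm id (Inr :: nat \<Rightarrow> 'a + nat) :: ('f, nat) trm \<Rightarrow> _)"
        by (rule trm.inj_map) auto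
      ultimately have "rep x = rep y" by (auto simp: j_def inj_def)
      thus "x = y" using rep(2) \<open>x \<in> S\<close> \<open>y \<in> S\<close> by metis
    qed
    define i where "i = inv_into S j"
    have ij: "i (j x) = x" if "x \<in> S" for x using that jinj by (simp add: i_def)
    have SB: "S \<subseteq> carrier B" using eval_closed[OF B] g XB by (auto simp: S_def T_def)
    have XS: "X \<subseteq> S"
    proof
      fix x assume "x \<in> X"
      then obtain n where "x = g n" using g by auto
      thus "x \<in> S" unfolding S_def by (intro image_eqI[of _ _ "Var n"]) (auto simp: T_def)
    qed
    have Sop: "oper B f xs \<in> S" if "length xs = ar f" "set xs \<subseteq> S" for f xs
    proof -
      have "Op f (map rep xs) \<in> T" using that rep(1) by (auto simp: T_def list_all_iff)
      moreover have "map (eval_trm B g \<circ> rep) xs = xs"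
        using that rep(2) by (intro map_idI) auto
      hence "eval_trm B g (Op f (map rep xs)) = oper B f xs" by simp
      ultimately show ?thesis unfolding S_def by (metis image_eqI)
    qed
    define C :: "(('f, 'a + nat) trm, 'f) ualg"
      where "C = \<lparr>carrier = j ` S, oper = \<lambda>f xs. j (oper B f (map i xs))\<rparr>"
    have cC: "carrier C = j ` S" and oC: "oper C f xs = j (oper B f (map i xs))" for f xs
      by (simp_all add: C_def)
    have iS: "i u \<in> S" if "u \<in> carrier C" for u using that ij by (auto simp: cC)
    have iargs: "map i xs \<in> args ar B f \<and> set (map i xs) \<subseteq> S \<and> length (map i xs) = ar f"
      if "xs \<in> args ar C f" for f xs
      using that iS SB by (fastforce simp: args_def)
    have C: "ualgebra ar C"
      using iargs Sop XS X(2) by (fastforce simp: ualgebra_def oC cC)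
    have ev: "eval_trm C \<rho> s \<in> carrier C \<and> i (eval_trm C \<rho> s) = eval_trm B (\<lambda>n. i (\<rho> n)) s"
      if \<rho>: "range \<rho> \<subseteq> carrier C" and "wf_trm ar s" for \<rho> and s :: "('f, nat) trm"
      using that(2)
    proof (induction s)
      case (Var x) thus ?case using \<rho> by auto
    next
      case (Op f ts)
      hence wf: "length ts = ar f" and IH: "\<And>t. t \<in> set ts \<Longrightarrow>
          eval_trm C \<rho> t \<in> carrier C \<and> i (eval_trm C \<rho> t) = eval_trm B (\<lambda>n. i (\<rho> n)) t"
        by (auto simp: list_all_iff)
      have arg: "map (eval_trm C \<rho>) ts \<in> args ar C f" using wf IH by (auto simp: args_def)
      have S: "oper B f (map i (map (eval_trm C \<rho>) ts)) \<in> S"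
        using iargs[OF arg] Sop by blast
      have E: "map i (map (eval_trm C \<rho>) ts) = map (eval_trm B (\<lambda>n. i (\<rho> n))) ts"
        using IH by simp
      have "eval_trm C \<rho> (Op f ts) = j (oper B f (map (eval_trm B (\<lambda>n. i (\<rho> n))) ts))"
        unfolding E[symmetric] by (simp add: oC)
      thus ?case using S unfolding E by (simp add: cC ij)
    qed
    have "in_variety ar A C"
      unfolding in_variety_def
    proof (intro conjI allI impI C)
      fix s t assume st: "wf_trm ar s" "wf_trm ar t" "sat_id A s t"
      have sB: "sat_id B s t" using BV st by (auto simp: in_variety_def)
      show "sat_id C s t" unfolding sat_id_def
      proof (intro allI impI)
        fix \<rho> :: "nat \<Rightarrow> ('f, 'a + nat) trm" assume \<rho>: "range \<rho> \<subseteq> carrier C"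
        have "range (\<lambda>n. i (\<rho> n)) \<subseteq> carrier B" using \<rho> iS SB by fastforce
        hence "i (eval_trm C \<rho> s) = i (eval_trm C \<rho> t)"
          using sB ev[OF \<rho> st(1)] ev[OF \<rho> st(2)] by (auto simp: sat_id_def)
        moreover have "inj_on i (carrier C)" using ij by (auto simp: cC inj_on_def)
        ultimately show "eval_trm C \<rho> s = eval_trm C \<rho> t"
          using ev[OF \<rho> st(1)] ev[OF \<rho> st(2)] by (auto simp: inj_on_def)
      qed
    qed
    hence MC: "congruence_modular ar C" using M by (auto simp: congruence_modular_variety_def)
    define pb where "pb \<theta> = {(u, v) \<in> carrier C \<times> carrier C. (i u, i v) \<in> \<theta>}" for \<theta>
    have pbC: "pb \<theta> \<in> Con ar C" if \<theta>: "\<theta> \<in> Con ar B" for \<theta>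
    proof -
      have "equiv (carrier B) \<theta>" using \<theta> by (auto simp: Con_def)
      hence "equiv (carrier C) (pb \<theta>)"
        using iS SB unfolding pb_def equiv_def refl_on_def sym_def trans_def by blast
      moreover have "(oper C f xs, oper C f ys) \<in> pb \<theta>"
        if xs: "xs \<in> args ar C f" and ys: "ys \<in> args ar C f"
          and l: "list_all2 (\<lambda>x y. (x, y) \<in> pb \<theta>) xs ys" for f xs ys
      proof -
        have "list_all2 (\<lambda>x y. (x, y) \<in> \<theta>) (map i xs) (map i ys)"
          using l unfolding list_all2_map1 list_all2_map2
          by (rule list_all2_mono) (auto simp: pb_def)
        hence "(oper B f (map i xs), oper B f (map i ys)) \<in> \<theta>"
          using \<theta> iargs[OF xs] iargs[OF ys] by (auto simp: Con_def)
        moreover have "oper B f (map i xs) \<in> S" "oper B f (map i ys) \<in> S"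
          using iargs[OF xs] iargs[OF ys] Sop by blast+
        ultimately show ?thesis by (simp add: pb_def oC cC ij)
      qed
      ultimately show ?thesis by (auto simp: Con_def)
    qed
    have abS: "a \<in> S" "b \<in> S" using X(2,3) XS by auto
    note JC = con_join_props[OF C pbC[OF c(1)] pbC[OF c(2)]]
    have "(j a, j b) \<in> (con_join ar C (pb \<alpha>) (pb \<beta>))"
      using X(5)
    proof (induction rule: rtrancl_induct)
      case base
      have "j a \<in> carrier C" using X(2) XS by (auto simp: cC)
      thus ?case using JC(1) by (auto simp: Con_def equiv_def refl_on_def)
    next
      case (step y z)
      have yz: "(y, z) \<in> \<alpha> \<union> \<beta>" "y \<in> S" "z \<in> S" using step.hyps(2) XS by blast+
      hence "(j y, j z) \<in> pb \<alpha> \<union> pb \<beta>" unfolding pb_def by (simp add: cC ij)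
      hence "(j y, j z) \<in> con_join ar C (pb \<alpha>) (pb \<beta>)" using JC(2,3) by blast
      moreover have "trans (con_join ar C (pb \<alpha>) (pb \<beta>))"
        using JC(1) by (simp add: Con_def equiv_def)
      ultimately show ?case using step.IH by (meson transD)
    qed
    moreover have "(j a, j b) \<in> pb \<gamma>" using p ab abS by (simp add: pb_def cC ij)
    moreover have "pb \<alpha> \<subseteq> pb \<gamma>" using ag by (auto simp: pb_def)
    ultimately have 1: "(j a, j b) \<in> con_join ar C (pb \<alpha>) (pb \<beta> \<inter> pb \<gamma>)"
      using MC pbC c unfolding congruence_modular_def by blast
    have "con_join ar C (pb \<alpha>) (pb \<beta> \<inter> pb \<gamma>) \<subseteq> pb (con_join ar B \<alpha> (\<beta> \<inter> \<gamma>))"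
      using K(2,3)
      by (intro con_join_props(4)[OF C] pbC Con_Int c K(1)) (auto simp: pb_def)
    hence "(i (j a), i (j b)) \<in> con_join ar B \<alpha> (\<beta> \<inter> \<gamma>)" using 1 by (auto simp: pb_def)
    thus "p \<in> con_join ar B \<alpha> (\<beta> \<inter> \<gamma>)" using ab abS ij by simp
  }
qed

end

theory Submission
  imports Defs
begin

text \<open>
  Write \<open>\<phi>\<^sup>+\<close> for the upper cover of \<open>\<phi>\<close>. Congruence orderability of \<open>A / \<phi>\<close> makes \<open>\<phi>\<^sup>+\<close> very
  small over a completely meet irreducible \<open>\<phi>\<close>: it arises from \<open>\<phi>\<close> by gluing together two
  \<open>\<phi>\<close>-classes, which form the block \<open>B\<close> of \<open>1\<close> (\<open>cover_splits_block\<close>). Hence a pair in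
  \<open>\<phi>\<^sup>+\<close> lies in \<open>\<phi>\<close> iff its two ends lie on the same side of \<open>B\<close>. When several members of \<open>U\<close>
  have the same cover \<open>\<kappa>\<close>, each of them is a function from pairs of elements of \<open>B\<close> to the
  two-element group, and the bullet operation is addition of these functions, with neutral
  element \<open>\<kappa>\<close>. The group laws are therefore identities of sets; what needs proof is that the
  members of \<open>U\<close> share their cover, and that \<open>U\<close> together with \<open>\<kappa>\<close> is closed under the operation.

  Both rest on two invariants of projectivity. A translation \<open>x \<mapsto> f (c\<^sub>1, \<dots>, x, \<dots>, c\<^sub>n)\<close> collapses an
  interval \<open>I[\<alpha>, \<beta>]\<close> if it maps \<open>\<beta>\<close> into \<open>\<alpha>\<close>, and the translations that collapse an interval do
  not change under transposition. A congruence \<open>\<theta>\<close> centralizes an interval if replacing the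
  parameters of a translation by \<open>\<theta>\<close>-related ones never changes whether it collapses. This is
  a form of the term condition. It is invariant too, it is closed under joins of congruences,
  and \<open>\<alpha>\<close> centralizes \<open>I[\<alpha>, \<beta>]\<close>. By these facts the property that \<open>\<beta>\<close> centralizes \<open>I[\<alpha>, \<beta>]\<close> (that
  the interval is abelian) is also invariant (\<open>projective_invariants\<close>).

  Congruence modularity enters once, in \<open>centralizer_le_cover\<close>: a congruence above \<open>\<phi>\<^sup>+\<close> that
  centralizes \<open>I[\<phi>, \<phi>\<^sup>+]\<close> is equal to \<open>\<phi>\<^sup>+\<close>. If \<open>\<phi>\<close> and \<open>\<psi>\<close> are related and their intervals abelian, then \<open>\<psi>\<^sup>+\<close>
  centralizes \<open>I[\<phi>, \<phi>\<^sup>+]\<close>, so does its join with \<open>\<phi>\<^sup>+\<close>, and thus \<open>\<psi>\<^sup>+ \<le> \<phi>\<^sup>+\<close>; by symmetry the covers agree. If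
  they are not abelian, then \<open>\<phi> \<or> \<psi>\<close> centralizes \<open>I[\<phi>, \<phi>\<^sup>+]\<close> and so is not above \<open>\<phi>\<^sup>+\<close>, which forces
  \<open>\<psi> \<le> \<phi>\<close>, and by symmetry \<open>\<phi> = \<psi>\<close>.

  For closure let \<open>\<phi> \<noteq> \<psi>\<close> be in \<open>U\<close> and let \<open>\<chi>\<close> consist of the pairs in \<open>\<kappa>\<close> on which \<open>\<phi>\<close> and \<open>\<psi>\<close>
  agree. A translation sends a pair outside \<open>\<phi>\<close> and \<open>\<psi>\<close> into \<open>\<phi>\<close> iff it collapses
  \<open>I[\<phi>, \<kappa>]\<close> iff it collapses \<open>I[\<psi>, \<kappa>]\<close>, so \<open>\<chi>\<close> is a congruence (\<open>agreement_congruence\<close>). The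
  interval \<open>I[\<phi> \<and> \<psi>, \<psi>]\<close> transposes up to both \<open>I[\<phi>, \<kappa>]\<close> and \<open>I[\<chi>, \<kappa>]\<close>. Finally \<open>\<kappa>\<close> is the least congruence
  strictly above \<open>\<chi>\<close>: a congruence \<open>\<theta>\<close> with \<open>\<theta> \<and> \<kappa> = \<chi>\<close> centralizes \<open>I[\<chi>, \<kappa>]\<close>, hence also
  \<open>I[\<phi>, \<kappa>]\<close>, hence lies below \<open>\<kappa>\<close> and equals \<open>\<chi>\<close> (\<open>agreement_Cm\<close>).
\<close>


section \<open>Homomorphisms, products and quotients\<close>

definition ualg_hom ::
  "('f \<Rightarrow> nat) \<Rightarrow> ('a, 'f) ualg \<Rightarrow> ('b, 'f) ualg \<Rightarrow> ('a \<Rightarrow> 'b) \<Rightarrow> bool" where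
  "ualg_hom ar A B h \<longleftrightarrow> h ` carrier A \<subseteq> carrier B \<and>
     (\<forall>f. \<forall>xs \<in> args ar A f. h (oper A f xs) = oper B f (map h xs))"

definition pullback :: "('a, 'f) ualg \<Rightarrow> ('a \<Rightarrow> 'b) \<Rightarrow> ('b \<times> 'b) set \<Rightarrow> ('a \<times> 'a) set" where
  "pullback A h \<theta> = {(x, y) \<in> carrier A \<times> carrier A. (h x, h y) \<in> \<theta>}"

lemma hom_args:
  assumes "ualg_hom ar A B h" "xs \<in> args ar A f"
  shows "map h xs \<in> args ar B f"
proof -
  have "h ` carrier A \<subseteq> carrier B" "length xs = ar f" "set xs \<subseteq> carrier A"
    using assms by (simp_all add: ualg_hom_def args_def)
  thus ?thesis by (auto simp: args_def)
qed

lemma pullback_Con: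
  assumes A: "ualgebra ar A" and h: "ualg_hom ar A B h" and \<theta>: "\<theta> \<in> Con ar B"
  shows "pullback A h \<theta> \<in> Con ar A"
proof -
  have hc: "h x \<in> carrier B" if "x \<in> carrier A" for x
    using h that by (auto simp: ualg_hom_def)
  have "equiv (carrier B) \<theta>" using \<theta> by (simp add: Con_def)
  hence "equiv (carrier A) (pullback A h \<theta>)"
    using hc unfolding pullback_def equiv_def refl_on_def sym_def trans_def by blast
  moreover have "(oper A f xs, oper A f ys) \<in> pullback A h \<theta>"
    if xs: "xs \<in> args ar A f" and ys: "ys \<in> args ar A f"
      and l: "list_all2 (\<lambda>x y. (x, y) \<in> pullback A h \<theta>) xs ys" for f xs ys
  proof -
    have "list_all2 (\<lambda>x y. (x, y) \<in> \<theta>) (map h xs) (map h ys)"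
      using l unfolding list_all2_map1 list_all2_map2
      by (rule list_all2_mono) (auto simp: pullback_def)
    hence "(oper B f (map h xs), oper B f (map h ys)) \<in> \<theta>"
      using \<theta> hom_args[OF h xs] hom_args[OF h ys] by (auto simp: Con_def)
    thus ?thesis
      using h xs ys A by (auto simp: pullback_def ualg_hom_def ualgebra_def)
  qed
  ultimately show ?thesis by (auto simp: Con_def)
qed

lemma eval_hom:
  assumes A: "ualgebra ar A" and h: "ualg_hom ar A B h"
    and \<rho>: "range \<rho> \<subseteq> carrier A" and "wf_trm ar s"
  shows "eval_trm B (\<lambda>n. h (\<rho> n)) s = h (eval_trm A \<rho> s)"
  using assms(4)
proof (induction s)
  case (Op f ts)
  hence arg: "map (eval_trm A \<rho>) ts \<in> args ar A f"
    using eval_closed[OF A \<rho>] by (auto simp: args_def list_all_iff)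
  have "map (eval_trm B (\<lambda>n. h (\<rho> n))) ts = map h (map (eval_trm A \<rho>) ts)"
    using Op by (auto simp: list_all_iff)
  thus ?case using h arg by (simp add: ualg_hom_def del: map_map)
qed simp

lemma const_val_eq:
  assumes A: "ualgebra ar A" and t: "constant_term ar A t"
    and \<rho>: "range \<rho> \<subseteq> carrier A"
  shows "eval_trm A \<rho> t = const_val A t"
proof -
  have "const_val A t = eval_trm A \<rho> t"
    unfolding const_val_def
  proof (rule the_equality)
    show "\<forall>\<sigma>. range \<sigma> \<subseteq> carrier A \<longrightarrow> eval_trm A \<sigma> t = eval_trm A \<rho> t"
      using t \<rho> unfolding constant_term_def by blast
  qed (use \<rho> in blast)
  thus ?thesis by (rule sym)
qed

lemma const_val_closed:
  assumes A: "ualgebra ar A" and t: "constant_term ar A t"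
  shows "const_val A t \<in> carrier A"
proof -
  obtain c where "c \<in> carrier A" using A by (auto simp: ualgebra_def)
  hence r: "range (\<lambda>_::nat. c) \<subseteq> carrier A" by auto
  have "wf_trm ar t" using t by (simp add: constant_term_def)
  hence "eval_trm A (\<lambda>_. c) t \<in> carrier A" by (rule eval_closed[OF A r])
  thus ?thesis by (simp only: const_val_eq[OF A t r])
qed

lemma const_val_hom_image:
  assumes A: "ualgebra ar A" and t: "constant_term ar A t"
    and h: "ualg_hom ar A B h" and surj: "h ` carrier A = carrier B"
  shows "const_val B t = h (const_val A t)"
proof -
  have eq: "eval_trm B \<sigma> t = h (const_val A t)" if \<sigma>: "range \<sigma> \<subseteq> carrier B" for \<sigma>
  proof -
    have "\<forall>n. \<exists>x. x \<in> carrier A \<and> h x = \<sigma> n" using \<sigma> surj by (metis imageE rangeI subsetD)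
    then obtain \<rho> where \<rho>: "\<And>n. \<rho> n \<in> carrier A" "\<And>n. h (\<rho> n) = \<sigma> n" by metis
    hence r: "range \<rho> \<subseteq> carrier A" by auto
    have "eval_trm B (\<lambda>n. h (\<rho> n)) t = h (eval_trm A \<rho> t)"
      using t by (intro eval_hom[OF A h r]) (simp add: constant_term_def)
    thus ?thesis using \<rho>(2) const_val_eq[OF A t r] by simp
  qed
  have r: "range (\<lambda>_::nat. h (const_val A t)) \<subseteq> carrier B"
    using surj const_val_closed[OF A t] by auto
  show ?thesis
    unfolding const_val_def[of B]
  proof (rule the_equality)
    show "\<forall>\<sigma>. range \<sigma> \<subseteq> carrier B \<longrightarrow> eval_trm B \<sigma> t = h (const_val A t)"
      using eq by blast
    show "c = h (const_val A t)"
      if "\<forall>\<sigma>. range \<sigma> \<subseteq> carrier B \<longrightarrow> eval_trm B \<sigma> t = c" for c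
      using that r eq[OF r] by auto
  qed
qed

text \<open>
  A congruence \<open>\<theta>\<close> is the carrier of a subalgebra of \<open>A \<times> A\<close>. Modularity of the congruence lattice
  of this algebra, rather than of \<open>A\<close>, is what bounds centralizers below.
\<close>

definition square_subalgebra :: "('a, 'f) ualg \<Rightarrow> ('a \<times> 'a) set \<Rightarrow> ('a \<times> 'a, 'f) ualg" where
  "square_subalgebra A \<theta> =
     \<lparr>carrier = \<theta>, oper = \<lambda>f ps. (oper A f (map fst ps), oper A f (map snd ps))\<rparr>"

lemma square_subalgebra_simps [simp]:
  "carrier (square_subalgebra A \<theta>) = \<theta>"
  "oper (square_subalgebra A \<theta>) f ps = (oper A f (map fst ps), oper A f (map snd ps))"
  by (simp_all add: square_subalgebra_def)

lemma square_args:
  assumes "\<theta> \<in> Con ar A" and "ps \<in> args ar (square_subalgebra A \<theta>) f"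
  shows "map fst ps \<in> args ar A f" "map snd ps \<in> args ar A f"
    and "list_all2 (\<lambda>x y. (x, y) \<in> \<theta>) (map fst ps) (map snd ps)"
proof -
  have ps: "set ps \<subseteq> \<theta>" "length ps = ar f" using assms(2) by (simp_all add: args_def)
  have "fst p \<in> carrier A \<and> snd p \<in> carrier A \<and> (fst p, snd p) \<in> \<theta>" if "p \<in> set ps" for p
  proof -
    have "p \<in> \<theta>" "p \<in> carrier A \<times> carrier A" using that ps(1) Con_subset[OF assms(1)] by blast+
    thus ?thesis by auto
  qed
  thus "map fst ps \<in> args ar A f" "map snd ps \<in> args ar A f"
    "list_all2 (\<lambda>x y. (x, y) \<in> \<theta>) (map fst ps) (map snd ps)"
    using ps(2) by (auto simp: args_def list_all2_conv_all_nth)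
qed

lemma square_ualgebra:
  assumes A: "ualgebra ar A" and \<theta>: "\<theta> \<in> Con ar A"
  shows "ualgebra ar (square_subalgebra A \<theta>)"
proof -
  obtain c where "c \<in> carrier A" using A by (auto simp: ualgebra_def)
  hence "(c, c) \<in> \<theta>" using \<theta> by (auto simp: Con_def equiv_def refl_on_def)
  moreover have "oper (square_subalgebra A \<theta>) f ps \<in> \<theta>"
    if "ps \<in> args ar (square_subalgebra A \<theta>) f" for f ps
    using square_args[OF \<theta> that] \<theta> by (auto simp: Con_def)
  ultimately show ?thesis by (auto simp: ualgebra_def)
qed

lemma square_projections:
  assumes \<theta>: "\<theta> \<in> Con ar A"
  shows "ualg_hom ar (square_subalgebra A \<theta>) A fst" "ualg_hom ar (square_subalgebra A \<theta>) A snd"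
  using Con_subset[OF \<theta>] by (auto simp: ualg_hom_def)

lemma square_in_variety:
  fixes A :: "('a, 'f) ualg"
  assumes A: "ualgebra ar A" and \<theta>: "\<theta> \<in> Con ar A"
  shows "in_variety ar A (square_subalgebra A \<theta>)"
  unfolding in_variety_def sat_id_def
proof (intro conjI allI impI square_ualgebra[OF A \<theta>])
  fix s t :: "('f, nat) trm" and \<rho> :: "nat \<Rightarrow> 'a \<times> 'a"
  assume wf: "wf_trm ar s" "wf_trm ar t"
    and id: "\<forall>\<rho>. range \<rho> \<subseteq> carrier A \<longrightarrow> eval_trm A \<rho> s = eval_trm A \<rho> t"
    and \<rho>: "range \<rho> \<subseteq> carrier (square_subalgebra A \<theta>)"
  have ev: "eval_trm (square_subalgebra A \<theta>) \<rho> u =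
      (eval_trm A (\<lambda>n. fst (\<rho> n)) u, eval_trm A (\<lambda>n. snd (\<rho> n)) u)" if "wf_trm ar u" for u
    using eval_hom[OF square_ualgebra[OF A \<theta>] square_projections(1)[OF \<theta>] \<rho> that]
      eval_hom[OF square_ualgebra[OF A \<theta>] square_projections(2)[OF \<theta>] \<rho> that]
    by simp
  have "range (\<lambda>n. fst (\<rho> n)) \<subseteq> carrier A" "range (\<lambda>n. snd (\<rho> n)) \<subseteq> carrier A"
    using \<rho> Con_subset[OF \<theta>] by fastforce+
  thus "eval_trm (square_subalgebra A \<theta>) \<rho> s = eval_trm (square_subalgebra A \<theta>) \<rho> t"
    using id ev wf by simp
qed

text \<open>
  Being strongly Fregean speaks of homomorphic images whose elements are sets. This isomorphic
  copy of \<open>A\<close> carries \<open>1\<close>-regularity back to \<open>A\<close> itself.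
\<close>

definition singleton_copy :: "('a, 'f) ualg \<Rightarrow> ('a set, 'f) ualg" where
  "singleton_copy A =
     \<lparr>carrier = (\<lambda>x. {x}) ` carrier A, oper = \<lambda>f Xs. {oper A f (map the_elem Xs)}\<rparr>"

lemma singleton_copy_homs:
  assumes A: "ualgebra ar A"
  shows "ualgebra ar (singleton_copy A)"
    and "ualg_hom ar A (singleton_copy A) (\<lambda>x. {x})"
    and "ualg_hom ar (singleton_copy A) A the_elem"
proof -
  have a: "map the_elem Xs \<in> args ar A f" if "Xs \<in> args ar (singleton_copy A) f" for f Xs
    using that by (auto simp: args_def singleton_copy_def)
  show "ualgebra ar (singleton_copy A)"
    using A a by (auto simp: ualgebra_def singleton_copy_def)
  show "ualg_hom ar A (singleton_copy A) (\<lambda>x. {x})"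
    by (auto simp: ualg_hom_def singleton_copy_def comp_def)
  show "ualg_hom ar (singleton_copy A) A the_elem"
    by (auto simp: ualg_hom_def singleton_copy_def)
qed

definition quotient_alg :: "('a, 'f) ualg \<Rightarrow> ('a \<times> 'a) set \<Rightarrow> ('a set, 'f) ualg" where
  "quotient_alg A \<phi> =
     \<lparr>carrier = carrier A // \<phi>, oper = \<lambda>f Xs. \<phi> `` {oper A f (map (\<lambda>X. SOME x. x \<in> X) Xs)}\<rparr>"

lemma quotient_alg_hom:
  assumes A: "ualgebra ar A" and \<phi>: "\<phi> \<in> Con ar A"
  shows "ualgebra ar (quotient_alg A \<phi>)"
    and "ualg_hom ar A (quotient_alg A \<phi>) (\<lambda>x. \<phi> `` {x})"
    and "(\<lambda>x. \<phi> `` {x}) ` carrier A = carrier (quotient_alg A \<phi>)"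
proof -
  have eq: "equiv (carrier A) \<phi>" using \<phi> by (simp add: Con_def)
  have some: "(SOME y. y \<in> X) \<in> X" if "X \<in> carrier A // \<phi>" for X
    using in_quotient_imp_non_empty[OF eq that] by (simp add: some_in_eq)
  have a: "map (\<lambda>X. SOME x. x \<in> X) Xs \<in> args ar A f"
    if "Xs \<in> args ar (quotient_alg A \<phi>) f" for f Xs
  proof -
    have "(SOME x. x \<in> X) \<in> carrier A" if "X \<in> set Xs" for X
      using \<open>Xs \<in> _\<close> that some[of X] in_quotient_imp_subset[OF eq, of X]
      by (auto simp: args_def quotient_alg_def)
    thus ?thesis using that by (auto simp: args_def)
  qed
  show "ualgebra ar (quotient_alg A \<phi>)"
    using A a by (auto simp: ualgebra_def quotient_alg_def quotientI)
  show "(\<lambda>x. \<phi> `` {x}) ` carrier A = carrier (quotient_alg A \<phi>)"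
    by (auto simp: quotient_alg_def quotient_def)
  show "ualg_hom ar A (quotient_alg A \<phi>) (\<lambda>x. \<phi> `` {x})"
    unfolding ualg_hom_def
  proof (intro conjI allI ballI)
    show "(\<lambda>x. \<phi> `` {x}) ` carrier A \<subseteq> carrier (quotient_alg A \<phi>)"
      by (auto simp: quotient_alg_def quotientI)
    fix f xs assume xs: "xs \<in> args ar A f"
    let ?ys = "map (\<lambda>X. SOME x. x \<in> X) (map (\<lambda>x. \<phi> `` {x}) xs)"
    have cl: "(x, SOME y. y \<in> \<phi> `` {x}) \<in> \<phi>" if "x \<in> set xs" for x
      using some[of "\<phi> `` {x}"] that xs by (auto simp: args_def quotientI)
    have "?ys \<in> args ar A f"
      using cl xs Con_subset[OF \<phi>] by (auto simp: args_def)
    moreover have "list_all2 (\<lambda>x y. (x, y) \<in> \<phi>) xs ?ys"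
      using cl by (auto simp: list_all2_conv_all_nth)
    ultimately have "(oper A f xs, oper A f ?ys) \<in> \<phi>"
      using \<phi> xs by (auto simp: Con_def)
    thus "\<phi> `` {oper A f xs} = oper (quotient_alg A \<phi>) f (map (\<lambda>x. \<phi> `` {x}) xs)"
      using equiv_class_eq[OF eq] by (simp add: quotient_alg_def)
  qed
qed


section \<open>Translations and the intervals that they collapse\<close>

lemma Con_equivD:
  assumes "\<theta> \<in> Con ar A"
  shows "x \<in> carrier A \<Longrightarrow> (x, x) \<in> \<theta>"
    and "(x, y) \<in> \<theta> \<Longrightarrow> (y, x) \<in> \<theta>"
    and "(x, y) \<in> \<theta> \<Longrightarrow> (y, z) \<in> \<theta> \<Longrightarrow> (x, z) \<in> \<theta>"
  using assms unfolding Con_def equiv_def by (auto dest: refl_onD symD transD)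

lemma args_update:
  assumes "cs \<in> args ar A f" "x \<in> carrier A"
  shows "cs[i := x] \<in> args ar A f"
  using assms set_update_subset_insert[of cs i x] by (auto simp: args_def)

lemma Con_oper:
  assumes "\<theta> \<in> Con ar A" "xs \<in> args ar A f" "ys \<in> args ar A f"
    and "list_all2 (\<lambda>x y. (x, y) \<in> \<theta>) xs ys"
  shows "(oper A f xs, oper A f ys) \<in> \<theta>"
  using assms by (auto simp: Con_def)

lemma Con_translation:
  assumes \<theta>: "\<theta> \<in> Con ar A" and cs: "cs \<in> args ar A f" and xy: "(x, y) \<in> \<theta>"
  shows "(oper A f (cs[i := x]), oper A f (cs[i := y])) \<in> \<theta>"
proof (rule Con_oper[OF \<theta>])
  have c: "x \<in> carrier A" "y \<in> carrier A" using xy Con_subset[OF \<theta>] by auto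
  show "cs[i := x] \<in> args ar A f" "cs[i := y] \<in> args ar A f" using args_update[OF cs] c by auto
  have "list_all2 (\<lambda>x y. (x, y) \<in> \<theta>) cs cs"
    using cs Con_equivD(1)[OF \<theta>] by (auto simp: args_def intro!: list_all2_same[THEN iffD2])
  thus "list_all2 (\<lambda>x y. (x, y) \<in> \<theta>) (cs[i := x]) (cs[i := y])"
    using xy by (intro list_all2_update_cong)
qed

text \<open>
  Two argument lists that are related entry by entry are joined by a chain of lists, each
  obtained from the one before by changing a single argument.
\<close>

lemma Con_by_translations:
  assumes A: "ualgebra ar A" and eq: "equiv (carrier A) \<theta>"
    and tr: "\<And>f i cs x y. cs \<in> args ar A f \<Longrightarrow> (x, y) \<in> \<theta> \<Longrightarrow>
      (oper A f (cs[i := x]), oper A f (cs[i := y])) \<in> \<theta>"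
  shows "\<theta> \<in> Con ar A"
proof -
  have "(oper A f xs, oper A f ys) \<in> \<theta>"
    if xs: "xs \<in> args ar A f" and ys: "ys \<in> args ar A f"
      and l: "list_all2 (\<lambda>x y. (x, y) \<in> \<theta>) xs ys" for f xs ys
  proof -
    have len: "length xs = ar f" "length ys = ar f" using xs ys by (auto simp: args_def)
    have "(oper A f xs, oper A f (take k ys @ drop k xs)) \<in> \<theta>" if "k \<le> ar f" for k
      using that
    proof (induction k)
      case 0
      thus ?case using A xs eq by (auto simp: ualgebra_def equiv_def refl_on_def)
    next
      case (Suc k)
      let ?zs = "take k ys @ drop k xs"
      have zs: "?zs \<in> args ar A f"
        using xs ys len Suc.prems by (auto simp: args_def dest: in_set_takeD in_set_dropD)
      have "(xs ! k, ys ! k) \<in> \<theta>" using l Suc.prems len by (auto simp: list_all2_conv_all_nth)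
      hence "(oper A f (?zs[k := xs ! k]), oper A f (?zs[k := ys ! k])) \<in> \<theta>" by (rule tr[OF zs])
      moreover have "?zs[k := xs ! k] = ?zs"
        using len Suc.prems by (intro nth_equalityI) (auto simp: nth_append nth_list_update)
      moreover have "?zs[k := ys ! k] = take (Suc k) ys @ drop (Suc k) xs"
        using len Suc.prems
        by (intro nth_equalityI) (auto simp: nth_append nth_list_update less_Suc_eq)
      ultimately have "(oper A f ?zs, oper A f (take (Suc k) ys @ drop (Suc k) xs)) \<in> \<theta>" by simp
      moreover have "(oper A f xs, oper A f ?zs) \<in> \<theta>" using Suc by simp
      ultimately show ?case using eq by (meson equivE transD)
    qed
    from this[of "ar f"] show ?thesis using len by simp
  qed
  thus ?thesis using eq by (auto simp: Con_def)
qed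

definition collapses :: "('a, 'f) ualg \<Rightarrow> 'f \<Rightarrow> nat \<Rightarrow> 'a list \<Rightarrow> 'a interval \<Rightarrow> bool" where
  "collapses A f i cs I \<longleftrightarrow>
     (\<forall>(x, y) \<in> snd I. (oper A f (cs[i := x]), oper A f (cs[i := y])) \<in> fst I)"

text \<open>
  Let \<open>I[\<alpha>, \<beta>]\<close> transpose up to \<open>I[\<gamma>, \<delta>]\<close>. A translation respects \<open>\<beta>\<close> and \<open>\<gamma>\<close>. If it maps
  \<open>\<delta>\<close> into \<open>\<gamma>\<close>, then it maps \<open>\<beta>\<close> into \<open>\<beta> \<and> \<gamma> = \<alpha>\<close>; if it maps \<open>\<beta>\<close> into \<open>\<alpha>\<close>, then it maps
  \<open>\<beta>\<close> and \<open>\<gamma>\<close>, hence also their join \<open>\<delta>\<close>, into \<open>\<gamma>\<close>.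
\<close>

lemma collapses_transpose:
  assumes A: "ualgebra ar A" and IJ: "transposes_up ar A I J" and cs: "cs \<in> args ar A f"
  shows "collapses A f i cs I \<longleftrightarrow> collapses A f i cs J"
proof -
  obtain \<alpha> \<beta> \<gamma> \<delta> where IJ_eq: "I = (\<alpha>, \<beta>)" "J = (\<gamma>, \<delta>)" by (cases I; cases J)
  have c: "\<beta> \<in> Con ar A" "\<gamma> \<in> Con ar A" "\<alpha> \<in> Con ar A"
    and meet: "\<beta> \<inter> \<gamma> = \<alpha>" and join: "con_join ar A \<beta> \<gamma> = \<delta>"
    using IJ by (auto simp: transposes_up_def is_interval_def IJ_eq)
  let ?g = "\<lambda>x. oper A f (cs[i := x])"
  have "collapses A f i cs I" if J: "collapses A f i cs J"
    unfolding collapses_def IJ_eq snd_conv fst_conv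
  proof (intro ballI, clarify)
    fix x y assume xy: "(x, y) \<in> \<beta>"
    hence "(x, y) \<in> \<delta>" using con_join_props(2)[OF A c(1,2)] join by blast
    hence "(?g x, ?g y) \<in> \<gamma>" using J by (auto simp: collapses_def IJ_eq)
    thus "(?g x, ?g y) \<in> \<alpha>" using Con_translation[OF c(1) cs xy] meet by blast
  qed
  moreover have "collapses A f i cs J" if I: "collapses A f i cs I"
    unfolding collapses_def IJ_eq snd_conv fst_conv
  proof (intro ballI, clarify)
    fix x y assume xy: "(x, y) \<in> \<delta>"
    have "(x, y) \<in> (\<beta> \<union> \<gamma>)\<^sup>*" and x: "x \<in> carrier A"
      using con_join_rtrancl[OF A c(1,2)] join xy by auto
    thus "(?g x, ?g y) \<in> \<gamma>"
    proof (induction rule: rtrancl_induct)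
      case base
      have "?g x \<in> carrier A" using A args_update[OF cs x] by (auto simp: ualgebra_def)
      thus ?case by (rule Con_equivD(1)[OF c(2)])
    next
      case (step y z)
      have "(?g y, ?g z) \<in> \<gamma>"
        using step.hyps(2) I meet Con_translation[OF c(2) cs]
        by (auto simp: collapses_def IJ_eq)
      thus ?case using step Con_equivD(3)[OF c(2)] by blast
    qed
  qed
  ultimately show ?thesis by blast
qed

text \<open>
  A form of the term condition \<open>C(\<theta>, \<beta>; \<alpha>)\<close> of commutator theory for \<open>I = I[\<alpha>, \<beta>]\<close>, with single
  operations in place of terms and quantified over all of \<open>\<beta>\<close> at once instead of pair by pair.
\<close>

definition centralizes ::
  "('f \<Rightarrow> nat) \<Rightarrow> ('a, 'f) ualg \<Rightarrow> ('a \<times> 'a) set \<Rightarrow> 'a interval \<Rightarrow> bool" where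
  "centralizes ar A \<theta> I \<longleftrightarrow>
     (\<forall>f i. \<forall>cs \<in> args ar A f. \<forall>ds \<in> args ar A f.
        list_all2 (\<lambda>x y. (x, y) \<in> \<theta>) cs ds \<longrightarrow> collapses A f i cs I = collapses A f i ds I)"

lemma centralizes_transpose:
  assumes "ualgebra ar A" "transposes_up ar A I J"
  shows "centralizes ar A \<theta> I \<longleftrightarrow> centralizes ar A \<theta> J"
  using collapses_transpose[OF assms] by (auto simp: centralizes_def)

lemma centralizes_mono:
  assumes "centralizes ar A \<theta> I" "\<theta>' \<subseteq> \<theta>"
  shows "centralizes ar A \<theta>' I"
proof -
  have "list_all2 (\<lambda>x y. (x, y) \<in> \<theta>) cs ds" if "list_all2 (\<lambda>x y. (x, y) \<in> \<theta>') cs ds" for cs ds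
    using that by (rule list_all2_mono) (use assms(2) in blast)
  thus ?thesis using assms(1) unfolding centralizes_def by blast
qed

lemma centralizes_bottom:
  assumes \<alpha>: "\<alpha> \<in> Con ar A" and \<beta>: "\<beta> \<subseteq> carrier A \<times> carrier A"
  shows "centralizes ar A \<alpha> (\<alpha>, \<beta>)"
proof -
  have "collapses A f i ds (\<alpha>, \<beta>)"
    if cs: "cs \<in> args ar A f" and ds: "ds \<in> args ar A f"
      and l: "list_all2 (\<lambda>x y. (x, y) \<in> \<alpha>) cs ds" and col: "collapses A f i cs (\<alpha>, \<beta>)"
    for f i cs ds
    unfolding collapses_def snd_conv fst_conv
  proof (intro ballI, clarify)
    fix x y assume xy: "(x, y) \<in> \<beta>"
    have move: "(oper A f (cs[i := z]), oper A f (ds[i := z])) \<in> \<alpha>" if "z \<in> carrier A" for z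
      using l that Con_equivD(1)[OF \<alpha>]
      by (intro Con_oper[OF \<alpha>] args_update cs ds list_all2_update_cong)
    have "(oper A f (cs[i := x]), oper A f (cs[i := y])) \<in> \<alpha>"
      using col xy by (auto simp: collapses_def)
    thus "(oper A f (ds[i := x]), oper A f (ds[i := y])) \<in> \<alpha>"
      using move[of x] move[of y] xy \<beta> Con_equivD(2,3)[OF \<alpha>] by blast
  qed
  moreover have "list_all2 (\<lambda>x y. (x, y) \<in> \<alpha>) ds cs"
    if "list_all2 (\<lambda>x y. (x, y) \<in> \<alpha>) cs ds" for cs ds
    using that Con_equivD(2)[OF \<alpha>] by (auto simp: list_all2_conv_all_nth)
  ultimately show ?thesis unfolding centralizes_def by blast
qed

text \<open>
  Argument lists related by the join are connected by a chain in which each step changes one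
  entry along one of the two congruences.
\<close>

lemma centralizes_join:
  assumes A: "ualgebra ar A" and c: "\<alpha> \<in> Con ar A" "\<beta> \<in> Con ar A"
    and cent: "centralizes ar A \<alpha> I" "centralizes ar A \<beta> I"
  shows "centralizes ar A (con_join ar A \<alpha> \<beta>) I"
  unfolding centralizes_def
proof (intro allI ballI impI)
  fix f i cs ds
  assume cs: "cs \<in> args ar A f" and ds: "ds \<in> args ar A f"
    and l: "list_all2 (\<lambda>x y. (x, y) \<in> con_join ar A \<alpha> \<beta>) cs ds"
  have one_step: "vs \<in> args ar A f \<and> collapses A f i us I = collapses A f i vs I"
    if us: "us \<in> args ar A f" and uv: "(us, vs) \<in> listrel1 (\<alpha> \<union> \<beta>)" for us vs
  proof -
    obtain ps x y qs where xy: "(x, y) \<in> \<alpha> \<union> \<beta>" "us = ps @ x # qs" "vs = ps @ y # qs"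
      using uv by (auto simp: listrel1_def)
    have vs: "vs \<in> args ar A f"
      using us xy Con_subset[OF c(1)] Con_subset[OF c(2)] by (auto simp: args_def)
    have "list_all2 (\<lambda>x y. (x, y) \<in> \<theta>) us vs" if "\<theta> \<in> Con ar A" "(x, y) \<in> \<theta>" for \<theta>
      using that us xy(2,3)
      by (auto simp: Con_def equiv_def refl_on_def args_def
          intro!: list_all2_appendI list_all2_same[THEN iffD2])
    thus ?thesis using c xy(1) cent us vs unfolding centralizes_def by blast
  qed
  have "(cs, ds) \<in> listrel ((\<alpha> \<union> \<beta>)\<^sup>*)"
    using l con_join_rtrancl[OF A c] by (auto simp: listrel_iff_zip list_all2_iff)
  hence "(cs, ds) \<in> (listrel1 (\<alpha> \<union> \<beta>))\<^sup>*" by (simp add: listrel_rtrancl_eq_rtrancl_listrel1)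
  hence "ds \<in> args ar A f \<and> collapses A f i cs I = collapses A f i ds I"
  proof (induction rule: rtrancl_induct)
    case base thus ?case using cs by simp
  next
    case (step us vs)
    thus ?case using one_step by blast
  qed
  thus "collapses A f i cs I = collapses A f i ds I" by simp
qed

lemma transposes_upI:
  assumes "ualgebra ar A" "\<beta> \<in> Con ar A" "\<gamma> \<in> Con ar A"
  shows "transposes_up ar A (\<beta> \<inter> \<gamma>, \<beta>) (\<gamma>, con_join ar A \<beta> \<gamma>)"
  using assms con_join_props[OF assms] Con_Int[OF assms(2,3)]
  by (auto simp: transposes_up_def is_interval_def)

lemma projective_invariants:
  assumes A: "ualgebra ar A" and IJ: "projective ar A I J"
  shows "cs \<in> args ar A f \<Longrightarrow> collapses A f i cs I \<longleftrightarrow> collapses A f i cs J"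
    and "centralizes ar A \<theta> I \<longleftrightarrow> centralizes ar A \<theta> J"
    and "centralizes ar A (snd I) I \<longleftrightarrow> centralizes ar A (snd J) J"
proof -
  have flag: "centralizes ar A (snd I) I \<longleftrightarrow> centralizes ar A (snd J) J"
    if IJ: "transposes_up ar A I J" for I J
  proof
    have c: "snd I \<in> Con ar A" "fst J \<in> Con ar A" "snd J \<in> Con ar A"
      and join: "con_join ar A (snd I) (fst J) = snd J"
      using IJ by (auto simp: transposes_up_def is_interval_def)
    {
      assume "centralizes ar A (snd I) I"
      hence "centralizes ar A (snd I) J" using centralizes_transpose[OF A IJ] by blast
      moreover have "centralizes ar A (fst J) J"
        using centralizes_bottom[OF c(2) Con_subset[OF c(3)]] by simp
      ultimately show "centralizes ar A (snd J) J"
        using centralizes_join[OF A c(1,2)] join by simp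
    next
      assume "centralizes ar A (snd J) J"
      hence "centralizes ar A (snd I) J"
        using con_join_props(2)[OF A c(1,2)] join centralizes_mono by metis
      thus "centralizes ar A (snd I) I" using centralizes_transpose[OF A IJ] by blast
    }
  qed
  have "(\<forall>cs \<in> args ar A f. collapses A f i cs I \<longleftrightarrow> collapses A f i cs J) \<and>
      (centralizes ar A \<theta> I \<longleftrightarrow> centralizes ar A \<theta> J) \<and>
      (centralizes ar A (snd I) I \<longleftrightarrow> centralizes ar A (snd J) J)"
    using IJ unfolding projective_def
  proof (induction rule: equivclp_induct)
    case (step J K)
    from step.hyps(2) show ?case
    proof
      assume JK: "transposes_up ar A J K"
      show ?thesis
        using step.IH collapses_transpose[OF A JK] centralizes_transpose[OF A JK] flag[OF JK] by simp
    next
      assume KJ: "transposes_up ar A K J"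
      show ?thesis
        using step.IH collapses_transpose[OF A KJ] centralizes_transpose[OF A KJ] flag[OF KJ] by simp
    qed
  qed simp
  note inv = this
  show "collapses A f i cs I \<longleftrightarrow> collapses A f i cs J" if "cs \<in> args ar A f"
    using inv[THEN conjunct1] that by (rule bspec)
  show "centralizes ar A \<theta> I \<longleftrightarrow> centralizes ar A \<theta> J"
    by (rule inv[THEN conjunct2, THEN conjunct1])
  show "centralizes ar A (snd I) I \<longleftrightarrow> centralizes ar A (snd J) J"
    by (rule inv[THEN conjunct2, THEN conjunct2])
qed


section \<open>Congruences that split one block into two\<close>

text \<open>
  For equivalence relations: \<open>\<kappa>\<close> glues together the \<open>\<phi>\<close>-classes that meet \<open>B\<close>, and there are
  at most two of them.
\<close>

definition splits_block :: "'a set \<Rightarrow> ('a \<times> 'a) set \<Rightarrow> ('a \<times> 'a) set \<Rightarrow> bool" where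
  "splits_block B \<phi> \<kappa> \<longleftrightarrow> \<kappa> = \<phi> \<union> B \<times> B \<and>
     (\<forall>x \<in> B. \<forall>y \<in> B. \<forall>z \<in> B. (x, y) \<in> \<phi> \<or> (y, z) \<in> \<phi> \<or> (x, z) \<in> \<phi>)"

text \<open>
  With only two sides, changing sides twice leads back. This is the source of all arithmetic
  modulo two in the theorem.
\<close>

lemma splits_block_parity:
  assumes s: "splits_block B \<phi> \<kappa>" and eq: "equiv C \<phi>"
    and xyz: "(x, y) \<in> \<kappa>" "(y, z) \<in> \<kappa>"
  shows "(x, z) \<in> \<phi> \<longleftrightarrow> ((x, y) \<in> \<phi> \<longleftrightarrow> (y, z) \<in> \<phi>)"
proof -
  have sym: "(v, u) \<in> \<phi>" if "(u, v) \<in> \<phi>" for u v using eq that by (meson equivE symD)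
  have trans: "(u, w) \<in> \<phi>" if "(u, v) \<in> \<phi>" "(v, w) \<in> \<phi>" for u v w
    using eq that by (meson equivE transD)
  have "(x, z) \<in> \<phi>" if "(x, y) \<notin> \<phi>" "(y, z) \<notin> \<phi>"
    using that xyz s unfolding splits_block_def by blast
  thus ?thesis using sym trans by blast
qed

lemma splits_block_pairs:
  assumes s: "splits_block B \<phi> \<kappa>" and eq: "equiv C \<phi>"
    and xy: "(x, y) \<in> \<kappa>" "(x, y) \<notin> \<phi>" and uv: "(u, v) \<in> \<kappa>" "(u, v) \<notin> \<phi>"
  shows "(u, x) \<in> \<phi> \<and> (v, y) \<in> \<phi> \<or> (u, y) \<in> \<phi> \<and> (v, x) \<in> \<phi>"
proof -
  have B: "x \<in> B" "y \<in> B" "u \<in> B" "v \<in> B" using xy uv s by (auto simp: splits_block_def)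
  hence k: "(p, q) \<in> \<kappa>" if "p \<in> B" "q \<in> B" for p q
    using that s by (auto simp: splits_block_def)
  show ?thesis
    using splits_block_parity[OF s eq, of u x y] splits_block_parity[OF s eq, of u v x]
      splits_block_parity[OF s eq, of u v y] splits_block_parity[OF s eq, of v x y] k B xy uv
    by blast
qed

text \<open>
  Every pair in \<open>\<kappa>\<close> outside \<open>\<phi>\<close> joins the same two \<open>\<phi>\<close>-classes, so one such pair decides whether
  a translation collapses the interval.
\<close>

lemma splits_block_collapses:
  assumes s: "splits_block B \<phi> \<kappa>" and \<phi>: "\<phi> \<in> Con ar A" and cs: "cs \<in> args ar A f"
    and xy: "(x, y) \<in> \<kappa>" "(x, y) \<notin> \<phi>"
  shows "collapses A f i cs (\<phi>, \<kappa>) \<longleftrightarrow> (oper A f (cs[i := x]), oper A f (cs[i := y])) \<in> \<phi>"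
proof
  assume "collapses A f i cs (\<phi>, \<kappa>)"
  thus "(oper A f (cs[i := x]), oper A f (cs[i := y])) \<in> \<phi>"
    using xy(1) by (auto simp: collapses_def)
next
  assume g: "(oper A f (cs[i := x]), oper A f (cs[i := y])) \<in> \<phi>"
  have eq: "equiv (carrier A) \<phi>" using \<phi> by (simp add: Con_def)
  note R = Con_equivD(2,3)[OF \<phi>] and T = Con_translation[OF \<phi> cs, where i = i]
  have "(oper A f (cs[i := u]), oper A f (cs[i := v])) \<in> \<phi>" if uv: "(u, v) \<in> \<kappa>" for u v
  proof (cases "(u, v) \<in> \<phi>")
    case True thus ?thesis by (rule T)
  next
    case False
    from splits_block_pairs[OF s eq xy uv False] show ?thesis
    proof (elim disjE conjE)
      assume "(u, x) \<in> \<phi>" "(v, y) \<in> \<phi>"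
      from R(2)[OF R(2)[OF T[OF this(1)] g] R(1)[OF T[OF this(2)]]] show ?thesis .
    next
      assume "(u, y) \<in> \<phi>" "(v, x) \<in> \<phi>"
      from R(2)[OF R(2)[OF T[OF this(1)] R(1)[OF g]] R(1)[OF T[OF this(2)]]] show ?thesis .
    qed
  qed
  thus "collapses A f i cs (\<phi>, \<kappa>)" by (auto simp: collapses_def)
qed

lemma splits_block_agreement:
  assumes s: "splits_block B \<phi> \<kappa>" "splits_block B \<psi> \<kappa>"
    and eq: "equiv C \<phi>" "equiv C \<psi>" "equiv C \<kappa>"
  defines "\<chi> \<equiv> {p \<in> \<kappa>. p \<in> \<phi> \<longleftrightarrow> p \<in> \<psi>}"
  shows "equiv C \<chi>" "splits_block B \<chi> \<kappa>"
proof -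
  note par = splits_block_parity[OF s(1) eq(1)] splits_block_parity[OF s(2) eq(2)]
  have "sym \<phi>" "sym \<psi>" "sym \<kappa>" using eq by (auto elim: equivE)
  hence sym: "(u, v) \<in> \<theta> \<Longrightarrow> (v, u) \<in> \<theta>" if "\<theta> \<in> {\<phi>, \<psi>, \<kappa>}" for u v \<theta>
    using that by (auto dest: symD)
  have "refl_on C \<chi>" using eq by (auto simp: \<chi>_def equiv_def refl_on_def)
  moreover have "\<chi> \<subseteq> C \<times> C" using eq(3) by (auto simp: \<chi>_def equiv_def)
  moreover have "sym \<chi>"
  proof (rule symI)
    fix x y assume "(x, y) \<in> \<chi>"
    thus "(y, x) \<in> \<chi>" using sym[of _ x y] sym[of _ y x] by (auto simp: \<chi>_def)
  qed
  moreover have "trans \<chi>"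
  proof (rule transI)
    fix x y z assume xyz: "(x, y) \<in> \<chi>" "(y, z) \<in> \<chi>"
    hence k: "(x, y) \<in> \<kappa>" "(y, z) \<in> \<kappa>" by (simp_all add: \<chi>_def)
    hence "(x, z) \<in> \<kappa>" using eq(3) by (meson equivE transD)
    thus "(x, z) \<in> \<chi>" using xyz par[OF k] by (simp add: \<chi>_def)
  qed
  ultimately show "equiv C \<chi>" by (auto simp: equiv_def)
  have k: "(x, y) \<in> \<kappa>" if "x \<in> B" "y \<in> B" for x y using that s(1) by (auto simp: splits_block_def)
  have "(x, y) \<in> \<chi> \<or> (y, z) \<in> \<chi> \<or> (x, z) \<in> \<chi>" if "x \<in> B" "y \<in> B" "z \<in> B" for x y z
    using that par[of x y z] k by (auto simp: \<chi>_def)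
  moreover have "\<kappa> = \<chi> \<union> B \<times> B" using s by (auto simp: splits_block_def \<chi>_def)
  ultimately show "splits_block B \<chi> \<kappa>" by (auto simp: splits_block_def)
qed


section \<open>Completely meet irreducible congruences\<close>

lemma Cm_Con: "\<phi> \<in> Cm ar A \<Longrightarrow> \<phi> \<in> Con ar A"
  by (simp add: Cm_def)

text \<open>
  Together with the next lemma: complete meet irreducibility is the existence of a least
  congruence strictly above.
\<close>

lemma upper_coverI:
  assumes \<phi>: "\<phi> \<in> Con ar A" and \<kappa>: "\<kappa> \<in> Con ar A" "\<phi> \<subset> \<kappa>"
    and least: "\<And>\<theta>. \<theta> \<in> Con ar A \<Longrightarrow> \<phi> \<subset> \<theta> \<Longrightarrow> \<kappa> \<subseteq> \<theta>"
  shows "\<phi> \<in> Cm ar A" "upper_cover ar A \<phi> = \<kappa>"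
proof -
  have "\<phi> \<in> S" if S: "S \<subseteq> Con ar A" "\<phi> = (carrier A \<times> carrier A) \<inter> \<Inter>S" for S
  proof (rule ccontr)
    assume "\<phi> \<notin> S"
    hence "\<kappa> \<subseteq> \<theta>" if "\<theta> \<in> S" for \<theta> using that S by (intro least) auto
    hence "\<kappa> \<subseteq> \<phi>" using S(2) Con_subset[OF \<kappa>(1)] by auto
    thus False using \<kappa>(2) by auto
  qed
  thus "\<phi> \<in> Cm ar A" using \<phi> by (auto simp: Cm_def)
  show "upper_cover ar A \<phi> = \<kappa>"
    unfolding upper_cover_def by (rule Least_equality) (use \<kappa> least in auto)
qed

lemma upper_cover:
  assumes A: "ualgebra ar A" and \<phi>: "\<phi> \<in> Cm ar A"
  shows "upper_cover ar A \<phi> \<in> Con ar A" "\<phi> \<subset> upper_cover ar A \<phi>"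
    and "\<And>\<theta>. \<theta> \<in> Con ar A \<Longrightarrow> \<phi> \<subset> \<theta> \<Longrightarrow> upper_cover ar A \<phi> \<subseteq> \<theta>"
proof -
  have \<phi>C: "\<phi> \<in> Con ar A" using \<phi> by (rule Cm_Con)
  \<comment> \<open>The meet of all congruences strictly above \<open>\<phi>\<close> contains a pair outside \<open>\<phi>\<close>; adjoining this
    pair to \<open>\<phi>\<close> generates the cover.\<close>
  define S where "S = {\<theta> \<in> Con ar A. \<phi> \<subset> \<theta>}"
  have "S \<subseteq> Con ar A" "\<phi> \<notin> S" by (auto simp: S_def)
  hence "\<phi> \<noteq> (carrier A \<times> carrier A) \<inter> \<Inter>S" using \<phi> unfolding Cm_def by blast
  moreover have "\<phi> \<subseteq> (carrier A \<times> carrier A) \<inter> \<Inter>S" using Con_subset[OF \<phi>C] by (auto simp: S_def)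
  ultimately obtain p where p: "p \<in> carrier A \<times> carrier A" "p \<in> \<Inter>S" "p \<notin> \<phi>" by blast
  define \<kappa> where "\<kappa> = con_gen ar A (insert p \<phi>)"
  have X: "insert p \<phi> \<subseteq> carrier A \<times> carrier A" using p Con_subset[OF \<phi>C] by auto
  note G = con_gen_eq[OF A X, folded \<kappa>_def]
  have \<kappa>: "\<phi> \<subset> \<kappa>" using G(1) X p(3) by auto
  have least: "\<kappa> \<subseteq> \<theta>" if "\<theta> \<in> Con ar A" "\<phi> \<subset> \<theta>" for \<theta>
    using that p(2) G(1) by (auto simp: S_def)
  have "upper_cover ar A \<phi> = \<kappa>" using upper_coverI[OF \<phi>C G(2) \<kappa>] least by blast
  thus "upper_cover ar A \<phi> \<in> Con ar A" "\<phi> \<subset> upper_cover ar A \<phi>"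
    "\<And>\<theta>. \<theta> \<in> Con ar A \<Longrightarrow> \<phi> \<subset> \<theta> \<Longrightarrow> upper_cover ar A \<phi> \<subseteq> \<theta>"
    using G(2) \<kappa> least by auto
qed


section \<open>Strongly Fregean algebras\<close>

locale strongly_Fregean_algebra =
  fixes ar :: "'f \<Rightarrow> nat" and A :: "('a, 'f) ualg" and t :: "('f, nat) trm"
  assumes A: "ualgebra ar A"
    and t: "constant_term ar A t"
    and sF: "strongly_Fregean ar A t"
begin

abbreviation unit_elt :: 'a where
  "unit_elt \<equiv> const_val A t"

abbreviation cover :: "('a \<times> 'a) set \<Rightarrow> ('a \<times> 'a) set" where
  "cover \<phi> \<equiv> upper_cover ar A \<phi>"

lemma Fregean_hom_image:
  fixes B :: "('a set, 'f) ualg"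
  assumes "ualgebra ar B" "ualg_hom ar A B h" "h ` carrier A = carrier B"
  shows "Fregean ar B t"
proof -
  have "homomorphic_image ar A B"
    using assms unfolding homomorphic_image_def ualg_hom_def by blast
  thus ?thesis using sF by (simp add: strongly_Fregean_def)
qed

text \<open>
  Regularity as a comparison: \<open>\<alpha>\<close> and \<open>\<alpha> \<inter> \<beta>\<close> have the same class of \<open>1\<close>.
\<close>

lemma unit_regular:
  assumes c: "\<alpha> \<in> Con ar A" "\<beta> \<in> Con ar A"
    and sub: "\<And>x. (unit_elt, x) \<in> \<alpha> \<Longrightarrow> (unit_elt, x) \<in> \<beta>"
  shows "\<alpha> \<subseteq> \<beta>"
proof -
  let ?B = "singleton_copy A"
  let ?P = "pullback ?B the_elem"
  note H = singleton_copy_homs[OF A]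
  have cB: "carrier ?B = (\<lambda>x. {x}) ` carrier A" by (simp add: singleton_copy_def)
  have P: "({x}, Y) \<in> ?P \<theta> \<longleftrightarrow> (\<exists>y. Y = {y} \<and> (x, y) \<in> \<theta>)" if "\<theta> \<in> Con ar A" for x Y \<theta>
    using Con_subset[OF that] by (auto simp: pullback_def cB)
  have i: "\<alpha> \<inter> \<beta> \<in> Con ar A" using c by (rule Con_Int)
  have "one_regular ar ?B t" using Fregean_hom_image[OF H(1,2)] cB by (simp add: Fregean_def)
  moreover have "const_val ?B t = {unit_elt}" using const_val_hom_image[OF A t H(2)] cB by simp
  moreover have "?P \<alpha> `` {{unit_elt}} = ?P (\<alpha> \<inter> \<beta>) `` {{unit_elt}}"
    using sub by (auto simp: P[OF c(1)] P[OF i])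
  ultimately have "?P \<alpha> = ?P (\<alpha> \<inter> \<beta>)"
    using pullback_Con[OF H(1,3) c(1)] pullback_Con[OF H(1,3) i] unfolding one_regular_def by metis
  hence "(x, y) \<in> \<alpha> \<longleftrightarrow> (x, y) \<in> \<alpha> \<inter> \<beta>" for x y
    using P[OF c(1), of x "{y}"] P[OF i, of x "{y}"] by auto
  thus ?thesis by auto
qed

text \<open>
  Congruence orderability of \<open>A / \<phi>\<close>, expressed in \<open>A\<close> by pulling congruences of the quotient
  back along the projection.
\<close>

lemma orderable_modulo:
  assumes \<phi>: "\<phi> \<in> Con ar A" and xy: "x \<in> carrier A" "y \<in> carrier A"
    and same: "\<And>\<theta>. \<theta> \<in> Con ar A \<Longrightarrow> \<phi> \<subseteq> \<theta> \<Longrightarrow> (unit_elt, x) \<in> \<theta> \<longleftrightarrow> (unit_elt, y) \<in> \<theta>"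
  shows "(x, y) \<in> \<phi>"
proof -
  let ?B = "quotient_alg A \<phi>" and ?h = "\<lambda>x. \<phi> `` {x}"
  note H = quotient_alg_hom[OF A \<phi>]
  have eq: "equiv (carrier A) \<phi>" using \<phi> by (simp add: Con_def)
  have u: "unit_elt \<in> carrier A" by (rule const_val_closed[OF A t])
  have hB: "?h z \<in> carrier ?B" if "z \<in> carrier A" for z using that H(3) by blast
  have same_B: "(?h unit_elt, ?h x) \<in> \<theta> \<longleftrightarrow> (?h unit_elt, ?h y) \<in> \<theta>" if "\<theta> \<in> Con ar ?B" for \<theta>
  proof -
    have "\<phi> \<subseteq> pullback A ?h \<theta>"
    proof (rule subrelI)
      fix v w assume vw: "(v, w) \<in> \<phi>"
      hence "v \<in> carrier A" "w \<in> carrier A" using Con_subset[OF \<phi>] by auto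
      moreover have "?h v = ?h w" using equiv_class_eq[OF eq vw] .
      ultimately show "(v, w) \<in> pullback A ?h \<theta>"
        using Con_equivD(1)[OF that hB] by (simp add: pullback_def)
    qed
    from same[OF pullback_Con[OF A H(2) that] this] show ?thesis
      using u xy by (simp add: pullback_def)
  qed
  have "{(?h unit_elt, ?h z)} \<subseteq> carrier ?B \<times> carrier ?B" if "z \<in> carrier A" for z
    using hB u that by blast
  note G = con_gen_eq(1)[OF H(1) this]
  have "Theta ar ?B (?h unit_elt) (?h x) = Theta ar ?B (?h unit_elt) (?h y)"
    unfolding Theta_def G[OF xy(1)] G[OF xy(2)] using same_B by (simp cong: conj_cong)
  moreover have "congruence_orderable ar ?B t" using Fregean_hom_image[OF H] by (simp add: Fregean_def)
  moreover have "const_val ?B t = ?h unit_elt" by (rule const_val_hom_image[OF A t H(2,3)])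
  ultimately have "?h x = ?h y" using hB xy unfolding congruence_orderable_def by metis
  thus ?thesis using eq_equiv_class[OF _ eq xy(2)] by blast
qed

text \<open>
  If neither \<open>x\<close> nor \<open>y\<close> is in the \<open>\<phi>\<close>-class of \<open>1\<close>, then a congruence above \<open>\<phi>\<close> that relates
  \<open>1\<close> to one of them lies strictly above \<open>\<phi>\<close>, so it contains \<open>(x, y)\<close> and relates \<open>1\<close> to the
  other. Orderability then identifies \<open>x\<close> and \<open>y\<close> modulo \<open>\<phi>\<close>.
\<close>

lemma cover_pair:
  assumes \<phi>: "\<phi> \<in> Cm ar A" and xy: "(x, y) \<in> cover \<phi>" "(x, y) \<notin> \<phi>"
  shows "(unit_elt, x) \<in> \<phi> \<or> (unit_elt, y) \<in> \<phi>"
proof (rule ccontr)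
  assume not: "\<not> ?thesis"
  note K = upper_cover[OF A \<phi>]
  have "(unit_elt, x) \<in> \<theta> \<longleftrightarrow> (unit_elt, y) \<in> \<theta>" if \<theta>: "\<theta> \<in> Con ar A" "\<phi> \<subseteq> \<theta>" for \<theta>
  proof (cases "\<phi> = \<theta>")
    case False
    hence "(x, y) \<in> \<theta>" using K(3)[OF \<theta>(1)] \<theta>(2) xy(1) by blast
    thus ?thesis using Con_equivD(2,3)[OF \<theta>(1)] by meson
  qed (use not in simp)
  moreover have "x \<in> carrier A" "y \<in> carrier A" using xy(1) Con_subset[OF K(1)] by auto
  ultimately have "(x, y) \<in> \<phi>" using orderable_modulo[OF Cm_Con[OF \<phi>]] by blast
  thus False using xy(2) by blast
qed

lemma cover_splits_block:
  assumes \<phi>: "\<phi> \<in> Cm ar A"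
  shows "splits_block (cover \<phi> `` {unit_elt}) \<phi> (cover \<phi>)"
proof -
  note K = upper_cover[OF A \<phi>] and R = Con_equivD(2,3)[OF Cm_Con[OF \<phi>]]
  note RK = Con_equivD(2,3)[OF K(1)]
  let ?B = "cover \<phi> `` {unit_elt}"
  have BB: "(x, y) \<in> cover \<phi>" if "x \<in> ?B" "y \<in> ?B" for x y
    using that RK by blast
  have "(x, y) \<in> \<phi> \<union> ?B \<times> ?B" if "(x, y) \<in> cover \<phi>" for x y
  proof (cases "(x, y) \<in> \<phi>")
    case False
    hence "(unit_elt, x) \<in> cover \<phi> \<or> (unit_elt, y) \<in> cover \<phi>"
      using cover_pair[OF \<phi> that] K(2) by blast
    thus ?thesis using RK that by blast
  qed simp
  hence "cover \<phi> = \<phi> \<union> ?B \<times> ?B" using BB K(2) by auto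
  moreover have "(x, y) \<in> \<phi> \<or> (y, z) \<in> \<phi> \<or> (x, z) \<in> \<phi>" if "x \<in> ?B" "y \<in> ?B" "z \<in> ?B" for x y z
    using cover_pair[OF \<phi> BB[OF that(1,2)]] cover_pair[OF \<phi> BB[OF that(2,3)]]
      cover_pair[OF \<phi> BB[OF that(1,3)]] R by meson
  ultimately show ?thesis unfolding splits_block_def by blast
qed

text \<open>
  A congruence on the algebra \<open>\<theta>\<close> of pairs: both coordinates move within a \<open>\<phi>\<^sup>+\<close>-class, and either
  both or neither of them changes its \<open>\<phi>\<close>-class. Transitivity is the parity of side changes;
  compatibility says that \<open>\<theta>\<close>-related parameters collapse alike.
\<close>

definition same_side :: "('a \<times> 'a) set \<Rightarrow> ('a \<times> 'a) set \<Rightarrow> (('a \<times> 'a) \<times> ('a \<times> 'a)) set" where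
  "same_side \<theta> \<phi> = {((x, y), (z, w)). (x, y) \<in> \<theta> \<and> (z, w) \<in> \<theta> \<and>
     (x, z) \<in> cover \<phi> \<and> (y, w) \<in> cover \<phi> \<and> ((x, z) \<in> \<phi> \<longleftrightarrow> (y, w) \<in> \<phi>)}"

lemma same_side_congruence:
  assumes \<phi>: "\<phi> \<in> Cm ar A" and \<theta>: "\<theta> \<in> Con ar A"
    and cent: "centralizes ar A \<theta> (\<phi>, cover \<phi>)"
  defines "\<Delta> \<equiv> same_side \<theta> \<phi>"
  shows "\<Delta> \<in> Con ar (square_subalgebra A \<theta>)"
proof (rule Con_by_translations[OF square_ualgebra[OF A \<theta>]])
  note K = upper_cover[OF A \<phi>] and \<phi>C = Cm_Con[OF \<phi>] and s = cover_splits_block[OF \<phi>]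
  have eq: "equiv (carrier A) \<phi>" using \<phi>C by (simp add: Con_def)
  note par = splits_block_parity[OF s eq]
  have "refl_on \<theta> \<Delta>"
    using Con_equivD(1)[OF K(1)] Con_equivD(1)[OF \<phi>C] Con_subset[OF \<theta>]
    by (auto simp: refl_on_def \<Delta>_def same_side_def)
  moreover have "\<Delta> \<subseteq> \<theta> \<times> \<theta>" by (auto simp: \<Delta>_def same_side_def)
  moreover have "sym \<Delta>"
    using Con_equivD(2)[OF K(1)] Con_equivD(2)[OF \<phi>C] by (auto simp: \<Delta>_def same_side_def intro!: symI)
  moreover have "trans \<Delta>"
  proof (rule transI, clarify)
    fix x y z w v u assume a: "((x, y), (z, w)) \<in> \<Delta>" "((z, w), (v, u)) \<in> \<Delta>"
    hence k: "(x, z) \<in> cover \<phi>" "(z, v) \<in> cover \<phi>" "(y, w) \<in> cover \<phi>" "(w, u) \<in> cover \<phi>"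
      by (simp_all add: \<Delta>_def same_side_def)
    show "((x, y), (v, u)) \<in> \<Delta>"
      using a par[OF k(1,2)] par[OF k(3,4)] Con_equivD(3)[OF K(1) k(1,2)] Con_equivD(3)[OF K(1) k(3,4)]
      by (simp add: \<Delta>_def same_side_def)
  qed
  ultimately show "equiv (carrier (square_subalgebra A \<theta>)) \<Delta>" by (simp add: equiv_def)
next
  note K = upper_cover[OF A \<phi>] and \<phi>C = Cm_Con[OF \<phi>] and s = cover_splits_block[OF \<phi>]
  fix f i ps p q
  assume ps: "ps \<in> args ar (square_subalgebra A \<theta>) f" and pq: "(p, q) \<in> \<Delta>"
  obtain x y z w where pq_eq: "p = (x, y)" "q = (z, w)" by (cases p; cases q)
  have d: "(x, y) \<in> \<theta>" "(z, w) \<in> \<theta>" "(x, z) \<in> cover \<phi>" "(y, w) \<in> cover \<phi>"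
    "(x, z) \<in> \<phi> \<longleftrightarrow> (y, w) \<in> \<phi>"
    using pq by (simp_all add: \<Delta>_def same_side_def pq_eq)
  let ?cs = "map fst ps" and ?ds = "map snd ps"
  let ?g = "\<lambda>x. oper A f (?cs[i := x])" and ?k = "\<lambda>x. oper A f (?ds[i := x])"
  note sq = square_args[OF \<theta> ps]
  have op: "oper (square_subalgebra A \<theta>) f (ps[i := (v, u)]) = (?g v, ?k u)" for v u
    by (simp add: map_update)
  have in_\<theta>: "(?g v, ?k u) \<in> \<theta>" if "(v, u) \<in> \<theta>" for v u
    using that Con_subset[OF \<theta>]
    by (intro Con_oper[OF \<theta>] args_update sq(1,2) list_all2_update_cong sq(3)) auto
  have same: "(?g x, ?g z) \<in> \<phi> \<longleftrightarrow> (?k y, ?k w) \<in> \<phi>"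
  proof (cases "(x, z) \<in> \<phi>")
    case True
    thus ?thesis using d(5) Con_translation[OF \<phi>C sq(1)] Con_translation[OF \<phi>C sq(2)] by blast
  next
    case False
    hence "(y, w) \<notin> \<phi>" using d(5) by blast
    have "collapses A f i ?cs (\<phi>, cover \<phi>) = collapses A f i ?ds (\<phi>, cover \<phi>)"
      using cent sq unfolding centralizes_def by blast
    thus ?thesis
      using splits_block_collapses[OF s \<phi>C sq(1) d(3) False]
        splits_block_collapses[OF s \<phi>C sq(2) d(4) \<open>(y, w) \<notin> \<phi>\<close>] by simp
  qed
  show "(oper (square_subalgebra A \<theta>) f (ps[i := p]), oper (square_subalgebra A \<theta>) f (ps[i := q])) \<in> \<Delta>"
    unfolding pq_eq op
    using in_\<theta>[OF d(1)] in_\<theta>[OF d(2)] same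
      Con_translation[OF K(1) sq(1) d(3)] Con_translation[OF K(1) sq(2) d(4)]
    by (simp add: \<Delta>_def same_side_def)
qed

text \<open>
  Choose \<open>a\<close> on the other side from \<open>1\<close> in the split block and let \<open>(1, b) \<in> \<theta>\<close>. On the algebra
  \<open>\<theta>\<close> of pairs let \<open>\<Delta>\<close> be the congruence \<open>same_side \<theta> \<phi>\<close>, let \<open>L\<close> be \<open>\<phi>\<close> on first coordinates and
  \<open>M\<close> be \<open>\<phi>\<^sup>+\<close> on second coordinates. The path \<open>(1, b), (1, 1), (a, a), (a, b)\<close> puts the pair of its ends
  into \<open>(\<Delta> \<or> L) \<and> M\<close>, which by modularity is \<open>\<Delta> \<or> (L \<and> M)\<close>. But if \<open>b\<close> is outside the block, all
  second coordinates on a path for the latter stay in one \<open>\<phi>\<close>-class. Then no step of \<open>\<Delta>\<close>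
  changes sides in the first coordinate, and \<open>1\<close> is never led to \<open>a\<close>.
\<close>

lemma centralizer_le_cover:
  assumes \<phi>: "\<phi> \<in> Cm ar A" and \<theta>: "\<theta> \<in> Con ar A" "cover \<phi> \<subseteq> \<theta>"
    and cent: "centralizes ar A \<theta> (\<phi>, cover \<phi>)"
  shows "\<theta> \<subseteq> cover \<phi>"
proof (rule unit_regular[OF \<theta>(1)])
  note K = upper_cover[OF A \<phi>] and \<phi>C = Cm_Con[OF \<phi>] and s = cover_splits_block[OF \<phi>]
  show "cover \<phi> \<in> Con ar A" by (rule K(1))
  fix b assume b: "(unit_elt, b) \<in> \<theta>"
  note R = Con_equivD[OF \<phi>C] and RK = Con_equivD[OF K(1)] and RT = Con_equivD[OF \<theta>(1)]
  obtain x y where "(x, y) \<in> cover \<phi>" "(x, y) \<notin> \<phi>" using K(2) by auto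
  then obtain a where a: "(unit_elt, a) \<in> cover \<phi>" "(unit_elt, a) \<notin> \<phi>"
    using cover_pair[OF \<phi>] R(2,3) RK(2,3) K(2) by (metis psubsetD)
  define T where "T = square_subalgebra A \<theta>"
  define \<Delta> where "\<Delta> = same_side \<theta> \<phi>"
  define L where "L = pullback T fst \<phi>"
  define M where "M = pullback T snd (cover \<phi>)"
  have TC: "ualgebra ar T" unfolding T_def by (rule square_ualgebra[OF A \<theta>(1)])
  have \<Delta>C: "\<Delta> \<in> Con ar T"
    unfolding T_def \<Delta>_def by (rule same_side_congruence[OF \<phi> \<theta>(1) cent])
  have LC: "L \<in> Con ar T" and MC: "M \<in> Con ar T"
    unfolding L_def M_def T_def
    using pullback_Con[OF square_ualgebra[OF A \<theta>(1)]] square_projections[OF \<theta>(1)] \<phi>C K(1) by blast+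
  have "congruence_modular ar T"
    unfolding T_def
    using congruence_modular_varietyD[OF _ square_in_variety[OF A \<theta>(1)]] sF
    by (simp add: strongly_Fregean_def)
  moreover have "\<Delta> \<subseteq> M" by (auto simp: \<Delta>_def same_side_def M_def pullback_def T_def)
  ultimately have modular: "con_join ar T \<Delta> L \<inter> M = con_join ar T \<Delta> (L \<inter> M)"
    using \<Delta>C LC MC unfolding congruence_modular_def by blast
  note J = con_join_props[OF TC \<Delta>C LC]
  have a\<theta>: "(a, a) \<in> \<theta>" "(unit_elt, unit_elt) \<in> \<theta>" "(a, b) \<in> \<theta>"
    using a(1) b \<theta>(2) RT(2,3) by blast+
  have l: "((unit_elt, b), (unit_elt, unit_elt)) \<in> L" "((a, a), (a, b)) \<in> L"
    using b a\<theta> R(1) Con_subset[OF \<theta>(1)] by (auto simp: L_def pullback_def T_def)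
  moreover have "((unit_elt, unit_elt), (a, a)) \<in> \<Delta>" using a a\<theta> by (simp add: \<Delta>_def same_side_def)
  ultimately have "((unit_elt, b), (a, b)) \<in> con_join ar T \<Delta> L"
    using J(2,3) Con_equivD(3)[OF J(1)] by blast
  moreover have "((unit_elt, b), (a, b)) \<in> M"
    using b a\<theta> RK(1) Con_subset[OF \<theta>(1)] by (auto simp: M_def pullback_def T_def)
  ultimately have "((unit_elt, b), (a, b)) \<in> con_join ar T \<Delta> (L \<inter> M)" using modular by blast
  hence path: "((unit_elt, b), (a, b)) \<in> (\<Delta> \<union> (L \<inter> M))\<^sup>*"
    using con_join_rtrancl[OF TC \<Delta>C Con_Int[OF LC MC]] by blast
  show "(unit_elt, b) \<in> cover \<phi>"
  proof (rule ccontr)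
    assume nb: "(unit_elt, b) \<notin> cover \<phi>"
    \<comment> \<open>\<open>b\<close> is outside the only block that \<open>\<phi>\<^sup>+\<close> enlarges.\<close>
    have near_b: "(b, v) \<in> \<phi>" if "(b, v) \<in> cover \<phi>" for v
      using that nb s RK(2) unfolding splits_block_def by blast
    have "(unit_elt, fst p) \<in> \<phi> \<and> (b, snd p) \<in> \<phi>"
      if "((unit_elt, b), p) \<in> (\<Delta> \<union> (L \<inter> M))\<^sup>*" for p
      using that
    proof (induction rule: rtrancl_induct)
      case base
      show ?case using R(1) b Con_subset[OF \<theta>(1)] by auto
    next
      case (step p q)
      obtain u v u' v' where pq: "p = (u, v)" "q = (u', v')" by (cases p; cases q)
      have IH: "(unit_elt, u) \<in> \<phi>" "(b, v) \<in> \<phi>" using step.IH pq by auto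
      have "(v, v') \<in> cover \<phi>"
        using step.hyps(2) by (auto simp: pq \<Delta>_def same_side_def M_def pullback_def)
      hence bv': "(b, v') \<in> \<phi>" using near_b RK(3) IH(2) K(2) by blast
      hence "(v, v') \<in> \<phi>" using IH(2) R(2,3) by blast
      hence "(u, u') \<in> \<phi>"
        using step.hyps(2) by (auto simp: pq \<Delta>_def same_side_def L_def pullback_def)
      thus ?case using IH(1) R(3) bv' pq by auto
    qed
    from this[OF path] show False using a(2) by simp
  qed
qed

text \<open>
  The two cases of the comparison of projective \<open>\<phi>\<close> and \<open>\<psi>\<close>. In the abelian case \<open>\<psi>\<^sup>+\<close>
  centralizes \<open>I[\<psi>, \<psi>\<^sup>+]\<close>, hence \<open>I[\<phi>, \<phi>\<^sup>+]\<close>. In the other case \<open>\<psi>\<close> still does, and no centralizer of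
  \<open>I[\<phi>, \<phi>\<^sup>+]\<close> contains \<open>\<phi>\<^sup>+\<close>.
\<close>

lemma abelian_cover_le:
  assumes \<phi>: "\<phi> \<in> Cm ar A" and \<psi>: "\<psi> \<in> Cm ar A"
    and pr: "projective ar A (\<phi>, cover \<phi>) (\<psi>, cover \<psi>)"
    and abelian: "centralizes ar A (cover \<phi>) (\<phi>, cover \<phi>)"
  shows "cover \<psi> \<subseteq> cover \<phi>"
proof -
  note K = upper_cover[OF A \<phi>] and K' = upper_cover[OF A \<psi>]
  note J = con_join_props[OF A K(1) K'(1)]
  have "centralizes ar A (cover \<psi>) (\<phi>, cover \<phi>)"
    using abelian projective_invariants(2,3)[OF A pr] by simp
  hence "centralizes ar A (con_join ar A (cover \<phi>) (cover \<psi>)) (\<phi>, cover \<phi>)"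
    by (rule centralizes_join[OF A K(1) K'(1) abelian])
  hence "con_join ar A (cover \<phi>) (cover \<psi>) \<subseteq> cover \<phi>"
    by (rule centralizer_le_cover[OF \<phi> J(1,2)])
  thus ?thesis using J(3) by blast
qed

lemma nonabelian_le:
  assumes \<phi>: "\<phi> \<in> Cm ar A" and \<psi>: "\<psi> \<in> Cm ar A"
    and pr: "projective ar A (\<phi>, cover \<phi>) (\<psi>, cover \<psi>)"
    and nonabelian: "\<not> centralizes ar A (cover \<phi>) (\<phi>, cover \<phi>)"
  shows "\<psi> \<subseteq> \<phi>"
proof -
  have c: "\<phi> \<in> Con ar A" "\<psi> \<in> Con ar A" using \<phi> \<psi> Cm_Con by auto
  note K = upper_cover[OF A \<phi>] and K' = upper_cover[OF A \<psi>] and J = con_join_props[OF A c]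
  have "centralizes ar A \<psi> (\<phi>, cover \<phi>)"
    using centralizes_bottom[OF c(2) Con_subset[OF K'(1)]] projective_invariants(2)[OF A pr] by simp
  hence "centralizes ar A (con_join ar A \<phi> \<psi>) (\<phi>, cover \<phi>)"
    using centralizes_join[OF A c] centralizes_bottom[OF c(1) Con_subset[OF K(1)]] by blast
  hence "\<not> cover \<phi> \<subseteq> con_join ar A \<phi> \<psi>" using nonabelian centralizes_mono by blast
  hence "\<phi> = con_join ar A \<phi> \<psi>" using K(3)[OF J(1)] J(2) by blast
  thus ?thesis using J(3) by simp
qed

lemma projective_cover:
  assumes \<phi>: "\<phi> \<in> Cm ar A" and \<psi>: "\<psi> \<in> Cm ar A" and ne: "\<phi> \<noteq> \<psi>"
    and pr: "projective ar A (\<phi>, cover \<phi>) (\<psi>, cover \<psi>)"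
  shows "centralizes ar A (cover \<phi>) (\<phi>, cover \<phi>)" "cover \<phi> = cover \<psi>"
proof -
  have pr': "projective ar A (\<psi>, cover \<psi>) (\<phi>, cover \<phi>)"
    using pr unfolding projective_def by (rule equivclp_sym)
  note flag = projective_invariants(3)[OF A pr, unfolded snd_conv]
  show ab: "centralizes ar A (cover \<phi>) (\<phi>, cover \<phi>)"
    using nonabelian_le[OF \<phi> \<psi> pr] nonabelian_le[OF \<psi> \<phi> pr'] flag ne by blast
  show "cover \<phi> = cover \<psi>"
    using abelian_cover_le[OF \<phi> \<psi> pr ab] abelian_cover_le[OF \<psi> \<phi> pr'] ab flag by blast
qed

lemma transposes_below_cover:
  assumes \<phi>: "\<phi> \<in> Cm ar A" and \<psi>: "\<psi> \<in> Con ar A" "\<psi> \<subseteq> cover \<phi>" "\<not> \<psi> \<subseteq> \<phi>"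
  shows "transposes_up ar A (\<psi> \<inter> \<phi>, \<psi>) (\<phi>, cover \<phi>)"
proof -
  note K = upper_cover[OF A \<phi>] and \<phi>C = Cm_Con[OF \<phi>]
  note J = con_join_props[OF A \<psi>(1) \<phi>C]
  have "cover \<phi> \<subseteq> con_join ar A \<psi> \<phi>" using K(3)[OF J(1)] J(2,3) \<psi>(3) by blast
  moreover have "con_join ar A \<psi> \<phi> \<subseteq> cover \<phi>" using J(4)[OF K(1)] K(2) \<psi>(2) by blast
  ultimately show ?thesis using transposes_upI[OF A \<psi>(1) \<phi>C] by simp
qed

text \<open>
  A translation keeps \<open>\<phi>\<close> and \<open>\<psi>\<close>, so it can break agreement only on a pair outside both. Such a
  pair tests collapsing for both intervals, with the same outcome since they are projective.
\<close>

lemma agreement_congruence: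
  assumes \<phi>: "\<phi> \<in> Cm ar A" and \<psi>: "\<psi> \<in> Cm ar A" and cov: "cover \<phi> = \<kappa>" "cover \<psi> = \<kappa>"
    and pr: "projective ar A (\<phi>, \<kappa>) (\<psi>, \<kappa>)"
  defines "\<chi> \<equiv> {p \<in> \<kappa>. p \<in> \<phi> \<longleftrightarrow> p \<in> \<psi>}"
  shows "\<chi> \<in> Con ar A"
proof (rule Con_by_translations[OF A])
  have c: "\<phi> \<in> Con ar A" "\<psi> \<in> Con ar A" using \<phi> \<psi> Cm_Con by auto
  have \<kappa>: "\<kappa> \<in> Con ar A" using upper_cover(1)[OF A \<phi>] cov by simp
  have s: "splits_block (\<kappa> `` {unit_elt}) \<phi> \<kappa>" "splits_block (\<kappa> `` {unit_elt}) \<psi> \<kappa>"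
    using cover_splits_block[OF \<phi>] cover_splits_block[OF \<psi>] cov by simp_all
  have eq: "equiv (carrier A) \<phi>" "equiv (carrier A) \<psi>" "equiv (carrier A) \<kappa>"
    using c \<kappa> by (simp_all add: Con_def)
  show "equiv (carrier A) \<chi>" unfolding \<chi>_def by (rule splits_block_agreement(1)[OF s eq])
  fix f i cs x y assume cs: "cs \<in> args ar A f" and xy: "(x, y) \<in> \<chi>"
  let ?g = "\<lambda>x. oper A f (cs[i := x])"
  have k: "(x, y) \<in> \<kappa>" "(x, y) \<in> \<phi> \<longleftrightarrow> (x, y) \<in> \<psi>" using xy by (simp_all add: \<chi>_def)
  have "(?g x, ?g y) \<in> \<phi> \<longleftrightarrow> (?g x, ?g y) \<in> \<psi>"
  proof (cases "(x, y) \<in> \<phi>")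
    case True
    thus ?thesis using k(2) Con_translation[OF c(1) cs] Con_translation[OF c(2) cs] by blast
  next
    case False
    hence "(x, y) \<notin> \<psi>" using k(2) by blast
    thus ?thesis
      using splits_block_collapses[OF s(1) c(1) cs k(1) False] splits_block_collapses[OF s(2) c(2) cs k(1)]
        projective_invariants(1)[OF A pr cs] by simp
  qed
  thus "(?g x, ?g y) \<in> \<chi>" using Con_translation[OF \<kappa> cs k(1)] by (simp add: \<chi>_def)
qed

text \<open>
  A congruence \<open>\<theta>\<close> strictly above \<open>\<chi>\<close> meets \<open>\<kappa>\<close> either in \<open>\<chi>\<close> or in more. In the first case \<open>\<theta>\<close>
  centralizes \<open>I[\<chi>, \<kappa>]\<close> by transposition to \<open>I[\<theta>, \<kappa> \<or> \<theta>]\<close>, so the bound on centralizers of the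
  abelian interval \<open>I[\<phi>, \<kappa>]\<close> applies to \<open>\<kappa> \<or> \<theta>\<close>. In the second case \<open>\<theta>\<close> connects
  the two sides into which \<open>\<chi>\<close> splits the block.
\<close>

lemma agreement_Cm:
  assumes \<phi>: "\<phi> \<in> Cm ar A" and \<psi>: "\<psi> \<in> Cm ar A" and ne: "\<phi> \<noteq> \<psi>"
    and cov: "cover \<phi> = \<kappa>" "cover \<psi> = \<kappa>"
    and pr: "projective ar A (\<phi>, \<kappa>) (\<psi>, \<kappa>)"
  defines "\<chi> \<equiv> {p \<in> \<kappa>. p \<in> \<phi> \<longleftrightarrow> p \<in> \<psi>}"
  shows "\<chi> \<in> Cm ar A" "cover \<chi> = \<kappa>" "projective ar A (\<phi>, \<kappa>) (\<chi>, \<kappa>)"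
proof -
  have c: "\<phi> \<in> Con ar A" "\<psi> \<in> Con ar A" using \<phi> \<psi> Cm_Con by auto
  note K = upper_cover[OF A \<phi>, unfolded cov] and K' = upper_cover[OF A \<psi>, unfolded cov]
  have \<chi>C: "\<chi> \<in> Con ar A"
    unfolding \<chi>_def by (rule agreement_congruence[OF \<phi> \<psi> cov pr])
  have s: "splits_block (\<kappa> `` {unit_elt}) \<phi> \<kappa>" "splits_block (\<kappa> `` {unit_elt}) \<psi> \<kappa>"
    using cover_splits_block[OF \<phi>] cover_splits_block[OF \<psi>] cov by simp_all
  have eq: "equiv (carrier A) \<phi>" "equiv (carrier A) \<psi>" "equiv (carrier A) \<kappa>" "equiv (carrier A) \<chi>"
    using c K(1) \<chi>C by (simp_all add: Con_def)
  have s\<chi>: "splits_block (\<kappa> `` {unit_elt}) \<chi> \<kappa>"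
    unfolding \<chi>_def by (rule splits_block_agreement(2)[OF s eq(1-3)])
  have incomparable: "\<not> \<phi> \<subseteq> \<psi>" "\<not> \<psi> \<subseteq> \<phi>"
    using K(2) K'(2) K(3)[OF c(2)] K'(3)[OF c(1)] ne by blast+
  obtain p q where pq: "(p, q) \<in> \<kappa>" "(p, q) \<notin> \<phi>" "(p, q) \<in> \<psi>" using incomparable K'(2) by auto
  obtain v w where vw: "(v, w) \<in> \<kappa>" "(v, w) \<notin> \<psi>" "(v, w) \<in> \<phi>" using incomparable K(2) by auto
  have B: "p \<in> \<kappa> `` {unit_elt}" "q \<in> \<kappa> `` {unit_elt}" "v \<in> \<kappa> `` {unit_elt}" "w \<in> \<kappa> `` {unit_elt}"
    using pq vw s unfolding splits_block_def by blast+
  have BB: "(x, y) \<in> \<kappa>" if "x \<in> \<kappa> `` {unit_elt}" "y \<in> \<kappa> `` {unit_elt}" for x y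
    using that s(1) unfolding splits_block_def by blast
  \<comment> \<open>\<open>\<chi>\<close> is not contained in \<open>\<psi>\<close>: among \<open>p, q, v, w\<close> there are two elements separated by both
    \<open>\<phi>\<close> and \<open>\<psi>\<close>.\<close>
  have "\<exists>x y. (x, y) \<in> \<kappa> \<and> (x, y) \<notin> \<phi> \<and> (x, y) \<notin> \<psi>"
  proof -
    have "(x, y) \<in> \<kappa>" if "x \<in> {p, q, v, w}" "y \<in> {p, q, v, w}" for x y
      using that B BB by blast
    hence k: "(p, v) \<in> \<kappa>" "(q, v) \<in> \<kappa>" "(p, w) \<in> \<kappa>" "(q, w) \<in> \<kappa>" "(p, q) \<in> \<kappa>" "(v, w) \<in> \<kappa>" by auto
    note P = splits_block_parity[OF s(1) eq(1)] splits_block_parity[OF s(2) eq(2)]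
    show ?thesis
      using P[OF k(5,2)] P[OF k(5,4)] P[OF k(1,6)] P[OF k(2,6)] pq vw k by blast
  qed
  then obtain x y where xy: "(x, y) \<in> \<kappa>" "(x, y) \<notin> \<phi>" "(x, y) \<notin> \<psi>" by blast
  have \<chi>\<kappa>: "\<chi> \<subset> \<kappa>" using pq by (auto simp: \<chi>_def)
  have \<chi>_above: "(x, y) \<in> \<chi>" using xy by (simp add: \<chi>_def)
  have meet: "\<chi> \<inter> \<psi> = \<phi> \<inter> \<psi>" using K'(2) by (auto simp: \<chi>_def)
  have up: "transposes_up ar A (\<psi> \<inter> \<phi>, \<psi>) (\<phi>, \<kappa>)"
    using transposes_below_cover[OF \<phi> c(2)] cov incomparable K'(2) by auto
  have up': "transposes_up ar A (\<psi> \<inter> \<chi>, \<psi>) (\<chi>, \<kappa>)"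
  proof -
    note J = con_join_props[OF A c(2) \<chi>C]
    have "\<kappa> \<subseteq> con_join ar A \<psi> \<chi>" using K'(3)[OF J(1)] J(2,3) \<chi>_above xy(3) by blast
    moreover have "con_join ar A \<psi> \<chi> \<subseteq> \<kappa>" using J(4)[OF K(1)] K'(2) \<chi>\<kappa> by blast
    ultimately show ?thesis using transposes_upI[OF A c(2) \<chi>C] by simp
  qed
  show pr\<chi>: "projective ar A (\<phi>, \<kappa>) (\<chi>, \<kappa>)"
  proof -
    have "\<psi> \<inter> \<chi> = \<psi> \<inter> \<phi>" using meet by blast
    hence "projective ar A (\<psi> \<inter> \<phi>, \<psi>) (\<chi>, \<kappa>)"
      using up' unfolding projective_def by (simp add: r_into_equivclp)
    moreover have "projective ar A (\<phi>, \<kappa>) (\<psi> \<inter> \<phi>, \<psi>)"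
      using up unfolding projective_def by (intro equivclp_sym[OF r_into_equivclp])
    ultimately show ?thesis unfolding projective_def by (rule equivclp_trans[rotated])
  qed
  have abelian: "centralizes ar A \<kappa> (\<phi>, \<kappa>)"
    using projective_cover(1)[OF \<phi> \<psi> ne] pr cov by simp
  have least: "\<kappa> \<subseteq> \<theta>" if \<theta>: "\<theta> \<in> Con ar A" "\<chi> \<subset> \<theta>" for \<theta>
  proof (cases "\<theta> \<inter> \<kappa> = \<chi>")
    case True
    have up\<theta>: "transposes_up ar A (\<chi>, \<kappa>) (\<theta>, con_join ar A \<kappa> \<theta>)"
      using transposes_upI[OF A K(1) \<theta>(1)] True by (simp add: Int_commute)
    note J = con_join_props[OF A K(1) \<theta>(1)]
    have "centralizes ar A \<theta> (\<chi>, \<kappa>)"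
      using centralizes_transpose[OF A up\<theta>] centralizes_bottom[OF \<theta>(1) Con_subset[OF J(1)]] by blast
    hence "centralizes ar A \<theta> (\<phi>, \<kappa>)" using projective_invariants(2)[OF A pr\<chi>] by blast
    hence "centralizes ar A (con_join ar A \<kappa> \<theta>) (\<phi>, \<kappa>)"
      by (rule centralizes_join[OF A K(1) \<theta>(1) abelian])
    hence "con_join ar A \<kappa> \<theta> \<subseteq> \<kappa>"
      using centralizer_le_cover[OF \<phi> J(1)] J(2) cov by simp
    hence "\<theta> \<subseteq> \<kappa>" using J(3) by blast
    thus ?thesis using True \<theta>(2) by blast
  next
    case False
    then obtain x y where xy: "(x, y) \<in> \<kappa>" "(x, y) \<in> \<theta>" "(x, y) \<notin> \<chi>" using \<theta>(2) \<chi>\<kappa> by auto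
    note R = Con_equivD(2,3)[OF \<theta>(1)]
    show ?thesis
    proof (rule subrelI)
      fix u v assume uv: "(u, v) \<in> \<kappa>"
      show "(u, v) \<in> \<theta>"
      proof (cases "(u, v) \<in> \<chi>")
        case False
        have "(u, x) \<in> \<theta> \<and> (v, y) \<in> \<theta> \<or> (u, y) \<in> \<theta> \<and> (v, x) \<in> \<theta>"
          using splits_block_pairs[OF s\<chi> eq(4) xy(1,3) uv False] \<theta>(2) by blast
        thus ?thesis using R xy(2) by meson
      qed (use \<theta>(2) in blast)
    qed
  qed
  show "\<chi> \<in> Cm ar A" "cover \<chi> = \<kappa>" using upper_coverI[OF \<chi>C K(1) \<chi>\<kappa>] least by blast+
qed

end


section \<open>The Boolean group\<close>

theorem theorem13:
  fixes ar :: "'f \<Rightarrow> nat" and A :: "('a, 'f) ualg" and t :: "('f, nat) trm"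
    and U :: "('a \<times> 'a) set set" and \<eta> :: "('a \<times> 'a) set"
  assumes "ualgebra ar A"
    and "constant_term ar A t"
    and "strongly_Fregean ar A t"
    and "U \<in> Cm ar A // Cm_rel ar A"
    and "\<eta> \<in> U"
  shows "\<exists>e. boolean_group \<lparr>carrier = extended_class ar A \<eta> U, mult = bullet ar A \<eta>, one = e\<rparr>"
proof -
  interpret strongly_Fregean_algebra ar A t using assms(1-3) by unfold_locales
  obtain \<rho> where \<rho>: "\<rho> \<in> Cm ar A" "U = Cm_rel ar A `` {\<rho>}" using assms(4) by (auto elim: quotientE)
  have U_Cm: "\<phi> \<in> Cm ar A" if "\<phi> \<in> U" for \<phi> using that \<rho>(2) by (auto simp: Cm_rel_def)
  have U_pr: "projective ar A (\<phi>, cover \<phi>) (\<psi>, cover \<psi>)" if "\<phi> \<in> U" "\<psi> \<in> U" for \<phi> \<psi>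
    using that \<rho>(2) unfolding Cm_rel_def projective_def
    by (auto intro: equivclp_trans equivclp_sym)
  have U_closed: "\<chi> \<in> U"
    if "\<phi> \<in> U" "\<chi> \<in> Cm ar A" "projective ar A (\<phi>, cover \<phi>) (\<chi>, cover \<chi>)" for \<phi> \<chi>
    using that \<rho> unfolding Cm_rel_def projective_def by (auto intro: equivclp_trans)
  define \<kappa> where "\<kappa> = cover \<eta>"
  have cov: "cover \<phi> = \<kappa>" if "\<phi> \<in> U" for \<phi>
    using projective_cover(2)[OF U_Cm U_Cm _ U_pr] that assms(5) unfolding \<kappa>_def by metis
  have \<kappa>: "\<kappa> \<subseteq> carrier A \<times> carrier A"
    using Con_subset upper_cover(1)[OF A U_Cm[OF assms(5)]] unfolding \<kappa>_def by blast
  let ?V = "insert \<kappa> U"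
  let ?m = "\<lambda>\<phi> \<psi>. {p \<in> \<kappa>. p \<in> \<phi> \<longleftrightarrow> p \<in> \<psi>}"
  have V: "\<phi> \<subseteq> \<kappa>" if "\<phi> \<in> ?V" for \<phi>
    using that upper_cover(2)[OF A U_Cm] cov by blast
  have closed: "?m \<phi> \<psi> \<in> ?V" if V': "\<phi> \<in> ?V" "\<psi> \<in> ?V" for \<phi> \<psi>
  proof (cases "\<phi> = \<kappa> \<or> \<psi> = \<kappa> \<or> \<phi> = \<psi>")
    case True
    thus ?thesis
    proof (elim disjE)
      assume eq: "\<phi> = \<kappa>"
      have "?m \<phi> \<psi> = \<psi>" unfolding eq using V[OF V'(2)] by blast
      thus ?thesis using V'(2) by (simp only:)
    next
      assume eq: "\<psi> = \<kappa>"
      have "?m \<phi> \<psi> = \<phi>" unfolding eq using V[OF V'(1)] by blast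
      thus ?thesis using V'(1) by (simp only:)
    next
      assume eq: "\<phi> = \<psi>"
      have "?m \<phi> \<psi> = \<kappa>" unfolding eq by blast
      thus ?thesis by (simp only: insertI1)
    qed
  next
    case False
    hence U: "\<phi> \<in> U" "\<psi> \<in> U" and ne: "\<phi> \<noteq> \<psi>" using V' by auto
    have "projective ar A (\<phi>, \<kappa>) (\<psi>, \<kappa>)" using U_pr[OF U] cov U by simp
    note C = agreement_Cm[OF U_Cm[OF U(1)] U_Cm[OF U(2)] ne cov[OF U(1)] cov[OF U(2)] this]
    show ?thesis using U_closed[OF U(1) C(1)] C(2,3) cov[OF U(1)] by simp
  qed
  let ?G = "\<lparr>carrier = extended_class ar A \<eta> U, mult = bullet ar A \<eta>, one = \<kappa>\<rparr>"
  have car: "carrier ?G = ?V" by (simp add: extended_class_def \<kappa>_def)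
  have mul: "mult ?G \<phi> \<psi> = ?m \<phi> \<psi>" for \<phi> \<psi>
    using \<kappa> by (auto simp: bullet_def \<kappa>_def)
  have one: "one ?G = \<kappa>" by simp
  have G: "group ?G"
  proof (rule groupI, unfold car mul one)
    fix \<phi> assume "\<phi> \<in> ?V"
    thus "?m \<kappa> \<phi> = \<phi>" "\<exists>\<psi>\<in>?V. ?m \<psi> \<phi> = \<kappa>" using V by blast+
  qed (use closed in blast)+
  moreover have "inv\<^bsub>?G\<^esub> \<phi> = \<phi>" if "\<phi> \<in> carrier ?G" for \<phi>
  proof (rule group.inv_equality[OF G _ that that], unfold mul one)
    show "?m \<phi> \<phi> = \<kappa>" by blast
  qed
  ultimately have "boolean_group ?G" unfolding boolean_group_def by blast
  thus ?thesis by blast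
qed

end
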